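(* There is an absolute constant $c>0$ such that the following holds. Let $k$ be a positive integer and let $\varepsilon_1,\varepsilon_2$ satisfy $0.01 \le \varepsilon_1 < \varepsilon_2 \le 0.49$ and $\varepsilon_2 - \varepsilon_1 \ge 2^{-O(k^{0.99})}$. Then any $(k,\varepsilon_1,\varepsilon_2)$-tolerant junta tester (possibly adaptive) must make at least $k^{-\Omega(\log(\varepsilon_2-\varepsilon_1))}$ queries, i.e. at least $k^{-c\log(\varepsilon_2-\varepsilon_1)}$ queries.
   Context: A function $f:\{0,1\}^n\to\{0,1\}$ is a $k$-junta if it depends on at most $k$ of its input variables. The distance between $f,g:\{0,1\}^n\to\{0,1\}$ is $\Pr_{x\sim\{0,1\}^n}[f(x)\neq g(x)]$ ($x$ uniform); $f$ is $\varepsilon$-close to a $k$-junta if its distance to some $k$-junta is at most $\varepsilon$, and $\varepsilon$-far from $k$-juntas if its distance to every $k$-junta is at least $\varepsilon$. A $(k,\varepsilon_1,\varepsilon_2)$-tolerant junta tester is a randomized algorithm with query access to $f:\{0,1\}^n\to\{0,1\}$ (queries may depend on previous answers) that accepts with probability at least $2/3$ if $f$ is $\varepsilon_1$-close to a $k$-junta and rejects with probability at least $2/3$ if $f$ is $\varepsilon_2$-far from $k$-juntas. Logarithms are base 2. *)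

theory Defs
  imports "HOL-Probability.Probability"
begin

text \<open>
  The cube \<open>{0,1}\<^sup>n\<close> is the set of bit lists of length \<open>n\<close>.  A function \<open>{0,1}\<^sup>n \<rightarrow> {0,1}\<close> is
  represented by a function on all bit lists, of which only the values on \<open>cube n\<close> matter.
\<close>

definition cube :: "nat \<Rightarrow> bool list set" where
  "cube n = {x. length x = n}"

definition depends_on :: "nat \<Rightarrow> (bool list \<Rightarrow> bool) \<Rightarrow> nat \<Rightarrow> bool" where
  "depends_on n f i \<longleftrightarrow> (\<exists>x \<in> cube n. f (x[i := \<not> x ! i]) \<noteq> f x)"

definition junta :: "nat \<Rightarrow> nat \<Rightarrow> (bool list \<Rightarrow> bool) \<Rightarrow> bool" where
  "junta n k f \<longleftrightarrow> card {i. i < n \<and> depends_on n f i} \<le> k"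

definition distance :: "nat \<Rightarrow> (bool list \<Rightarrow> bool) \<Rightarrow> (bool list \<Rightarrow> bool) \<Rightarrow> real" where
  "distance n f g = measure_pmf.prob (pmf_of_set (cube n)) {x. f x \<noteq> g x}"

definition close_to_junta :: "nat \<Rightarrow> nat \<Rightarrow> real \<Rightarrow> (bool list \<Rightarrow> bool) \<Rightarrow> bool" where
  "close_to_junta n k \<epsilon> f \<longleftrightarrow> (\<exists>g. junta n k g \<and> distance n f g \<le> \<epsilon>)"

definition far_from_juntas :: "nat \<Rightarrow> nat \<Rightarrow> real \<Rightarrow> (bool list \<Rightarrow> bool) \<Rightarrow> bool" where
  "far_from_juntas n k \<epsilon> f \<longleftrightarrow> (\<forall>g. junta n k g \<longrightarrow> distance n f g \<ge> \<epsilon>)"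

text \<open>
  A deterministic adaptive query algorithm is a decision tree: \<open>Query x t0 t1\<close> queries the point
  \<open>x\<close> and continues with \<open>t0\<close> or \<open>t1\<close> if the answer is \<open>0\<close> or \<open>1\<close>, respectively;
  \<open>Answer True\<close> accepts and \<open>Answer False\<close> rejects.
\<close>

datatype query_tree = Answer bool | Query "bool list" query_tree query_tree

primrec queries_within :: "bool list set \<Rightarrow> query_tree \<Rightarrow> bool" where
  "queries_within X (Answer b) \<longleftrightarrow> True"
| "queries_within X (Query x t0 t1) \<longleftrightarrow> x \<in> X \<and> queries_within X t0 \<and> queries_within X t1"

primrec accepts :: "(bool list \<Rightarrow> bool) \<Rightarrow> query_tree \<Rightarrow> bool" where
  "accepts f (Answer b) \<longleftrightarrow> b"
| "accepts f (Query x t0 t1) \<longleftrightarrow> (if f x then accepts f t1 else accepts f t0)"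

primrec num_queries :: "(bool list \<Rightarrow> bool) \<Rightarrow> query_tree \<Rightarrow> nat" where
  "num_queries f (Answer b) = 0"
| "num_queries f (Query x t0 t1) = Suc (if f x then num_queries f t1 else num_queries f t0)"

text \<open>
  A randomized query algorithm is a probability distribution over deterministic ones.  There are
  only countably many decision trees, so discrete distributions lose no generality.
\<close>

definition tolerant_junta_tester ::
    "nat \<Rightarrow> nat \<Rightarrow> real \<Rightarrow> real \<Rightarrow> query_tree pmf \<Rightarrow> bool" where
  "tolerant_junta_tester n k \<epsilon>1 \<epsilon>2 T \<longleftrightarrow>
     (\<forall>t \<in> set_pmf T. queries_within (cube n) t) \<and>
     (\<forall>f. (close_to_junta n k \<epsilon>1 f \<longrightarrow> measure_pmf.prob T {t. accepts f t} \<ge> 2 / 3) \<and>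
          (far_from_juntas n k \<epsilon>2 f \<longrightarrow> measure_pmf.prob T {t. \<not> accepts f t} \<ge> 2 / 3))"

definition makes_at_most :: "nat \<Rightarrow> query_tree pmf \<Rightarrow> bool" where
  "makes_at_most q T \<longleftrightarrow> (\<forall>t \<in> set_pmf T. \<forall>f. num_queries f t \<le> q)"

end

theory Submission
  imports Defs
begin

text \<open>
  Let \<open>f\<close> be a uniformly random function of \<open>k + a\<close> variables.  Averaging over \<open>a\<close> variables leaves a
  bias of order \<open>2 powr (- a / 2)\<close>, so \<open>f\<close> is about that far below distance \<open>1 / 2\<close> from \<open>k\<close>-juntas.
  If \<open>f\<close> is instead random subject to being invariant under flipping any of a constant number of hidden
  disjoint blocks of \<open>t\<close> variables, whose union has size \<open>a\<close>, then averaging over the hidden variables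
  leaves a bias that is larger by a constant factor, and \<open>f\<close> is closer to \<open>k\<close>-juntas.  The two cases look
  the same until two queries differ exactly in a union of blocks; for a random choice of the blocks this
  happens for a fixed pair of queries with probability about \<open>(a / k) ^ t\<close>, so about \<open>(k / a) powr (t / 2)\<close>
  queries are needed.  Setting \<open>f\<close> to \<open>0\<close> on a suitable part of the cube moves the two distances to the
  prescribed \<open>\<epsilon>1 < \<epsilon>2\<close>.
\<close>

section \<open>Counting on the cube\<close>

text \<open>Both random functions are read off one uniformly random set
  \<open>G \<subseteq> U\<close>, where \<open>U\<close> is the part of the cube not forced to
  \<open>0\<close>: the far one is \<open>ones x \<in> G\<close>, the close one is
  \<open>key \<phi> (ones x) \<in> G\<close>. Membership in \<open>U\<close> is decided by
  coordinates that are never hidden, so a query outside \<open>U\<close> is answered alike in both.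
  The obstacle is adaptivity: later queries depend on earlier answers and hence on
  \<open>\<phi>\<close>. It is removed by fixing a complete transcript before \<open>\<phi>\<close>
  is drawn; its queried points are then a fixed set, and without collisions equally many
  \<open>G\<close> produce it in both models.

  The number of blocks has to be constant, so that the block size \<open>t\<close> is proportional
  to the logarithm of the gap; this yields the exponent. Each block multiplies the typical bias by
  \<open>sqrt 2\<close>, and 22 of them pay for the constant losses (Khinchine, density, rounding).
  Gaps above \<open>2 powr (- 11)\<close> are served by blocks of size one, and \<open>k\<close>
  small relative to \<open>C\<close> by a bound of two queries.\<close>

lemma finite_cube [simp]: "finite (cube n)"
  and card_cube: "card (cube n) = 2 ^ n"
proof -
  have eq: "cube n = {xs :: bool list. set xs \<subseteq> UNIV \<and> length xs = n}"
    by (auto simp: cube_def)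
  show "finite (cube n)" unfolding eq by (rule finite_lists_length_eq) simp
  show "card (cube n) = 2 ^ n" unfolding eq by (subst card_lists_length_eq) simp_all
qed

lemma cube_nonempty: "cube n \<noteq> {}"
  using card_cube[of n] by force

lemma distance_eq: "distance n f g = real (card {x \<in> cube n. f x \<noteq> g x}) / 2 ^ n"
proof -
  have "cube n \<inter> {x. f x \<noteq> g x} = {x \<in> cube n. f x \<noteq> g x}" by auto
  then show ?thesis
    by (simp add: distance_def measure_pmf_of_set cube_nonempty card_cube)
qed

lemma card_cube_split:
  assumes "m \<le> n"
  shows "card {x \<in> cube n. P x} = (\<Sum>z \<in> cube (n - m). card {y \<in> cube m. P (y @ z)})"
proof -
  have "bij_betw (\<lambda>(z, y). y @ z) (SIGMA z : cube (n - m). {y \<in> cube m. P (y @ z)}) {x \<in> cube n. P x}"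
    by (rule bij_betw_byWitness[where f' = "\<lambda>x. (drop m x, take m x)"])
       (use assms in \<open>auto simp: cube_def\<close>)
  from bij_betw_same_card[OF this] show ?thesis by simp
qed

section \<open>Restricting a tester to fewer variables\<close>

lemma depends_on_append:
  assumes "m \<le> n" "z \<in> cube (n - m)" "i < m" "depends_on m (\<lambda>y. g (y @ z)) i"
  shows "depends_on n g i"
proof -
  from assms(4) obtain y where y: "y \<in> cube m" "g (y[i := \<not> y ! i] @ z) \<noteq> g (y @ z)"
    by (auto simp: depends_on_def)
  then have "y @ z \<in> cube n" "(y @ z)[i := \<not> (y @ z) ! i] = y[i := \<not> y ! i] @ z"
    using assms by (auto simp: cube_def list_update_append nth_append)
  with y show ?thesis unfolding depends_on_def by metis
qed

lemma depends_on_take: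
  assumes "m \<le> n" "i < n" "depends_on n (\<lambda>x. g (take m x)) i"
  shows "i < m \<and> depends_on m g i"
proof -
  from assms(3) obtain x where x: "x \<in> cube n" "g (take m (x[i := \<not> x ! i])) \<noteq> g (take m x)"
    by (auto simp: depends_on_def)
  have im: "i < m"
    using x(2) by (rule contrapos_np) simp
  then have "take m x \<in> cube m" "take m (x[i := \<not> x ! i]) = (take m x)[i := \<not> take m x ! i]"
    using x assms by (auto simp: cube_def take_update_swap)
  with x im show ?thesis unfolding depends_on_def by metis
qed

lemma junta_mono:
  assumes "{i. i < m \<and> depends_on m f i} \<subseteq> {i. i < n \<and> depends_on n g i}" "junta n k g"
  shows "junta m k f"
proof -
  have "finite {i. i < n \<and> depends_on n g i}" by simp
  from card_mono[OF this assms(1)] show ?thesis using assms(2) unfolding junta_def by linarith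
qed

text \<open>Fixing the last \<open>n - m\<close> bits of a junta leaves a junta in the first
  \<open>m\<close> variables, so \<open>f\<close> disagrees with it on at least an
  \<open>\<epsilon>\<close> fraction of every slice.\<close>

lemma far_from_juntas_take:
  assumes "m \<le> n" "far_from_juntas m k \<epsilon> f"
  shows "far_from_juntas n k \<epsilon> (\<lambda>x. f (take m x))"
  unfolding far_from_juntas_def
proof (intro allI impI)
  fix g assume g: "junta n k g"
  have "\<epsilon> * 2 ^ m \<le> real (card {y \<in> cube m. f y \<noteq> g (y @ z)})" if z: "z \<in> cube (n - m)" for z
  proof -
    have "{i. i < m \<and> depends_on m (\<lambda>y. g (y @ z)) i} \<subseteq> {i. i < n \<and> depends_on n g i}"
      using depends_on_append[OF assms(1) z, where g = g] assms(1) by auto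
    then have "junta m k (\<lambda>y. g (y @ z))"
      using g junta_mono by blast
    then have "\<epsilon> \<le> distance m f (\<lambda>y. g (y @ z))"
      using assms(2) by (auto simp: far_from_juntas_def)
    then show ?thesis by (simp add: distance_eq field_simps)
  qed
  then have "(\<Sum>z \<in> cube (n - m). \<epsilon> * 2 ^ m) \<le> (\<Sum>z \<in> cube (n - m). real (card {y \<in> cube m. f y \<noteq> g (y @ z)}))"
    by (rule sum_mono)
  also have "\<dots> = real (\<Sum>z \<in> cube (n - m). card {y \<in> cube m. f (take m (y @ z)) \<noteq> g (y @ z)})"
    by (simp add: cube_def cong: conj_cong)
  also have "\<dots> = real (card {x \<in> cube n. f (take m x) \<noteq> g x})"
    by (subst card_cube_split[OF assms(1)]) simp
  moreover have "(2::real) ^ n = 2 ^ m * 2 ^ (n - m)"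
    using assms(1) by (simp add: power_add[symmetric])
  ultimately have "\<epsilon> * 2 ^ n \<le> real (card {x \<in> cube n. f (take m x) \<noteq> g x})"
    by (simp add: card_cube mult_ac)
  then show "\<epsilon> \<le> distance n (\<lambda>x. f (take m x)) g"
    by (simp add: distance_eq field_simps)
qed

lemma close_to_junta_take:
  assumes "m \<le> n" "close_to_junta m k \<epsilon> f"
  shows "close_to_junta n k \<epsilon> (\<lambda>x. f (take m x))"
proof -
  from assms(2) obtain g where g: "junta m k g" "distance m f g \<le> \<epsilon>"
    by (auto simp: close_to_junta_def)
  have "{i. i < n \<and> depends_on n (\<lambda>x. g (take m x)) i} \<subseteq> {i. i < m \<and> depends_on m g i}"
    using depends_on_take[OF assms(1), where g = g] by auto
  then have "junta n k (\<lambda>x. g (take m x))"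
    using g(1) junta_mono by blast
  moreover have "card {x \<in> cube n. f (take m x) \<noteq> g (take m x)}
      = (\<Sum>z \<in> cube (n - m). card {y \<in> cube m. f y \<noteq> g y})"
    by (subst card_cube_split[OF assms(1)]) (simp add: cube_def cong: conj_cong)
  then have "card {x \<in> cube n. f (take m x) \<noteq> g (take m x)} = 2 ^ (n - m) * card {y \<in> cube m. f y \<noteq> g y}"
    by (simp add: card_cube)
  then have "distance n (\<lambda>x. f (take m x)) (\<lambda>x. g (take m x)) = distance m f g"
    using assms(1) by (simp add: distance_eq field_simps power_add[symmetric])
  ultimately show ?thesis using g(2) unfolding close_to_junta_def by metis
qed

primrec map_queries :: "(bool list \<Rightarrow> bool list) \<Rightarrow> query_tree \<Rightarrow> query_tree" where
  "map_queries h (Answer b) = Answer b"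
| "map_queries h (Query x t0 t1) = Query (h x) (map_queries h t0) (map_queries h t1)"

lemma accepts_map_queries: "accepts f (map_queries h t) = accepts (\<lambda>x. f (h x)) t"
  by (induction t) auto

lemma num_queries_map_queries: "num_queries f (map_queries h t) = num_queries (\<lambda>x. f (h x)) t"
  by (induction t) auto

lemma queries_within_map_queries:
  "queries_within X t \<Longrightarrow> h ` X \<subseteq> Y \<Longrightarrow> queries_within Y (map_queries h t)"
  by (induction t) auto

text \<open>The hard functions live on slightly more than \<open>k\<close> variables, while the
  tester is given for one large \<open>n\<close>; truncating its queries simulates it on functions
  padded with irrelevant variables.\<close>

lemma tolerant_junta_tester_take:
  assumes "m \<le> n" "tolerant_junta_tester n k \<epsilon>1 \<epsilon>2 T"
  shows "tolerant_junta_tester m k \<epsilon>1 \<epsilon>2 (map_pmf (map_queries (take m)) T)"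
proof -
  have "take m ` cube n \<subseteq> cube m" using assms(1) by (auto simp: cube_def)
  then have "queries_within (cube m) (map_queries (take m) t)" if "t \<in> set_pmf T" for t
    using assms(2) that queries_within_map_queries by (auto simp: tolerant_junta_tester_def)
  moreover have "measure_pmf.prob T {t. accepts (\<lambda>x. f (take m x)) t} \<ge> 2 / 3"
    if "close_to_junta m k \<epsilon>1 f" for f
    using assms(2) close_to_junta_take[OF assms(1) that] by (simp add: tolerant_junta_tester_def)
  moreover have "measure_pmf.prob T {t. \<not> accepts (\<lambda>x. f (take m x)) t} \<ge> 2 / 3"
    if "far_from_juntas m k \<epsilon>2 f" for f
    using assms(2) far_from_juntas_take[OF assms(1) that] by (simp add: tolerant_junta_tester_def)
  ultimately show ?thesis
    by (auto simp: tolerant_junta_tester_def vimage_def accepts_map_queries)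
qed

lemma makes_at_most_map_queries:
  "makes_at_most q T \<Longrightarrow> makes_at_most q (map_pmf (map_queries h) T)"
  by (auto simp: makes_at_most_def num_queries_map_queries)

section \<open>Distance to juntas via fibre sums\<close>

definition ones :: "bool list \<Rightarrow> nat set" where
  "ones x = {i. i < length x \<and> x ! i}"

definition bits :: "nat \<Rightarrow> nat set \<Rightarrow> bool list" where
  "bits m X = map (\<lambda>i. i \<in> X) [0..<m]"

lemma ones_bits: "X \<subseteq> {..<m} \<Longrightarrow> ones (bits m X) = X"
  by (auto simp: ones_def bits_def)

lemma bits_ones: "x \<in> cube m \<Longrightarrow> bits m (ones x) = x"
  by (auto simp: ones_def bits_def cube_def intro: nth_equalityI)

lemma bits_in_cube: "bits m X \<in> cube m"
  by (simp add: bits_def cube_def)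

lemma ones_subset: "x \<in> cube m \<Longrightarrow> ones x \<subseteq> {..<m}"
  by (auto simp: ones_def cube_def)

lemma bij_betw_ones: "bij_betw ones (cube m) (Pow {..<m})"
  by (rule bij_betw_byWitness[where f' = "bits m"])
     (auto simp: ones_bits bits_ones bits_in_cube dest: ones_subset)

definition pm :: "bool \<Rightarrow> real" where
  "pm b = (if b then 1 else -1)"

lemma pm_simps [simp]: "pm True = 1" "pm False = -1" "pm b * pm b = 1" "\<bar>pm b\<bar> = 1"
  by (auto simp: pm_def)

text \<open>
  For a \<open>\<plusminus>1\<close>-valued \<open>\<sigma>\<close> on the whole cube this is the largest correlation of \<open>\<sigma>\<close> with a function
  of the coordinates in \<open>S\<close>.
\<close>
definition fibre_sum :: "nat set \<Rightarrow> nat set set \<Rightarrow> (nat set \<Rightarrow> real) \<Rightarrow> real" where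
  "fibre_sum S P \<sigma> = (\<Sum>D \<in> Pow S. \<bar>\<Sum>X \<in> {X \<in> P. X \<inter> S = D}. \<sigma> X\<bar>)"

lemma sum_fibres:
  assumes "finite P" "finite S"
  shows "(\<Sum>D \<in> Pow S. \<Sum>X \<in> {X \<in> P. X \<inter> S = D}. h X) = (\<Sum>X \<in> P. h X)"
  by (rule sum.group) (use assms in auto)

lemma disagreements_eq:
  assumes "\<And>X. X \<subseteq> {..<m} \<Longrightarrow> g (bits m X) = H X"
  shows "2 * real (card {x \<in> cube m. F (ones x) \<noteq> g x})
    = 2 ^ m - (\<Sum>X \<in> Pow {..<m}. pm (F X) * pm (H X))"
proof -
  have "bij_betw ones {x \<in> cube m. F (ones x) \<noteq> g x} {X \<in> Pow {..<m}. F X \<noteq> H X}"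
  proof (rule bij_betw_byWitness[where f' = "bits m"])
    have "g x = H (ones x)" if "x \<in> cube m" for x
      using assms[OF ones_subset[OF that]] bits_ones[OF that] by simp
    then show "ones ` {x \<in> cube m. F (ones x) \<noteq> g x} \<subseteq> {X \<in> Pow {..<m}. F X \<noteq> H X}"
      using ones_subset by blast
  qed (auto simp: ones_bits bits_ones bits_in_cube assms)
  then have "card {x \<in> cube m. F (ones x) \<noteq> g x} = card {X \<in> Pow {..<m}. F X \<noteq> H X}"
    by (rule bij_betw_same_card)
  moreover have "(\<Sum>X \<in> Pow {..<m}. pm (F X) * pm (H X))
      = (\<Sum>X \<in> Pow {..<m}. 1 - 2 * (if F X \<noteq> H X then 1 else 0))"
    by (rule sum.cong) (auto simp: pm_def)
  moreover have "\<dots> = 2 ^ m - 2 * real (card {X \<in> Pow {..<m}. F X \<noteq> H X})"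
    by (simp add: sum_subtractf sum_distrib_left[symmetric] card_Pow sum.If_cases Int_def)
  ultimately show ?thesis by simp
qed

lemma bits_flip:
  assumes "i < m"
  shows "(bits m X)[i := \<not> bits m X ! i] = bits m (if i \<in> X then X - {i} else insert i X)"
  using assms by (auto simp: bits_def nth_list_update split: if_splits intro!: nth_equalityI)

text \<open>The coordinates outside \<open>S\<close> are cleared one at a time; each clearing is
  void or flips a variable on which \<open>g\<close> does not depend.\<close>

lemma junta_determined_by:
  assumes "\<And>i. i < m \<Longrightarrow> depends_on m g i \<Longrightarrow> i \<in> S" "X \<subseteq> {..<m}"
  shows "g (bits m (X \<inter> S)) = g (bits m X)"
proof -
  have drop: "g (bits m (Y - {i})) = g (bits m Y)" if "i < m" "i \<notin> S" for Y i
  proof (cases "i \<in> Y")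
    case True
    have "\<not> depends_on m g i" using assms(1) that by blast
    then have "g ((bits m Y)[i := \<not> bits m Y ! i]) = g (bits m Y)"
      using bits_in_cube by (auto simp: depends_on_def)
    then show ?thesis using True that by (simp add: bits_flip)
  qed simp
  have "g (bits m (X - E)) = g (bits m X)" if "finite E" "E \<subseteq> {..<m} - S" for E
    using that
  proof (induction E rule: finite_induct)
    case (insert i E)
    have "g (bits m (X - E - {i})) = g (bits m (X - E))" using insert.prems by (intro drop) auto
    also have "X - E - {i} = X - insert i E" by auto
    finally show ?case using insert by auto
  qed simp
  from this[of "{..<m} - S"] have "g (bits m (X - ({..<m} - S))) = g (bits m X)" by simp
  moreover have "X - ({..<m} - S) = X \<inter> S" using assms(2) by auto
  ultimately show ?thesis by simp
qed

text \<open>A function of the coordinates in \<open>S\<close> is constant on each fibre of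
  \<open>X \<inter> S\<close>, so its correlation with \<open>F\<close> is at most the sum of the
  absolute fibre sums. The relevant variables are padded to exactly \<open>k\<close>, so that a
  later union bound runs over one family of \<open>m choose k\<close> sets.\<close>

lemma far_from_juntas_fibre_sum:
  assumes "k \<le> m"
    and "\<And>S. S \<subseteq> {..<m} \<Longrightarrow> card S = k \<Longrightarrow>
           fibre_sum S (Pow {..<m}) (\<lambda>X. pm (F X)) \<le> (1 - 2 * \<epsilon>) * 2 ^ m"
  shows "far_from_juntas m k \<epsilon> (\<lambda>x. F (ones x))"
  unfolding far_from_juntas_def
proof (intro allI impI)
  fix g assume "junta m k g"
  then have "card {i. i < m \<and> depends_on m g i} \<le> k" by (simp add: junta_def)
  then obtain S where S: "{i. i < m \<and> depends_on m g i} \<subseteq> S" "S \<subseteq> {..<m}" "card S = k"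
    using exists_subset_between[of "{i. i < m \<and> depends_on m g i}" k "{..<m}"] assms(1) by auto
  then have finS: "finite S" using finite_subset by blast
  define H where "H D = g (bits m D)" for D
  have H: "H X = H (X \<inter> S)" if "X \<subseteq> {..<m}" for X
    using junta_determined_by[of m g S X] S(1) that unfolding H_def by auto
  have "(\<Sum>X \<in> Pow {..<m}. pm (F X) * pm (H X))
      = (\<Sum>D \<in> Pow S. \<Sum>X \<in> {X \<in> Pow {..<m}. X \<inter> S = D}. pm (F X) * pm (H X))"
    by (rule sum_fibres[symmetric]) (use finS in auto)
  also have "\<dots> = (\<Sum>D \<in> Pow S. pm (H D) * (\<Sum>X \<in> {X \<in> Pow {..<m}. X \<inter> S = D}. pm (F X)))"
    unfolding sum_distrib_left by (intro sum.cong refl) (use H in auto)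
  also have "\<dots> \<le> (\<Sum>D \<in> Pow S. \<bar>\<Sum>X \<in> {X \<in> Pow {..<m}. X \<inter> S = D}. pm (F X)\<bar>)"
    by (intro sum_mono) (auto simp: pm_def)
  also have "\<dots> \<le> (1 - 2 * \<epsilon>) * 2 ^ m"
    using assms(2)[OF S(2,3)] by (simp add: fibre_sum_def)
  finally have "2 * \<epsilon> * 2 ^ m \<le> 2 * real (card {x \<in> cube m. F (ones x) \<noteq> g x})"
    by (subst disagreements_eq[where H = H]) (auto simp: H_def algebra_simps)
  then show "\<epsilon> \<le> distance m (\<lambda>x. F (ones x)) g"
    by (simp add: distance_eq field_simps)
qed

text \<open>The majority vote on each fibre turns every fibre sum into its absolute value, so the
  correlation bound for functions of the coordinates in \<open>S\<close> is attained.\<close>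

lemma close_to_junta_fibre_sum:
  assumes "S \<subseteq> {..<m}" "card S \<le> k"
    and "(1 - 2 * \<epsilon>) * 2 ^ m \<le> fibre_sum S (Pow {..<m}) (\<lambda>X. pm (F X))"
  shows "close_to_junta m k \<epsilon> (\<lambda>x. F (ones x))"
proof -
  define a where "a D = (\<Sum>X \<in> {X \<in> Pow {..<m}. X \<inter> S = D}. pm (F X))" for D
  define H where "H X \<longleftrightarrow> a (X \<inter> S) > 0" for X
  define g where "g x \<longleftrightarrow> H (ones x)" for x
  have finS: "finite S" using assms(1) finite_subset by blast
  have "i \<in> S" if i: "i < m" "depends_on m g i" for i
  proof (rule ccontr)
    assume "i \<notin> S"
    then have "ones (x[i := b]) \<inter> S = ones x \<inter> S" for x b
      by (auto simp: ones_def) (metis nth_list_update_neq)+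
    then show False using i(2) by (auto simp: depends_on_def g_def H_def)
  qed
  then have "junta m k g"
    using assms(2) card_mono[OF finS, of "{i. i < m \<and> depends_on m g i}"]
    by (auto simp: junta_def intro: order_trans)
  moreover have "(\<Sum>X \<in> Pow {..<m}. pm (F X) * pm (H X)) = fibre_sum S (Pow {..<m}) (\<lambda>X. pm (F X))"
  proof -
    have "(\<Sum>X \<in> Pow {..<m}. pm (F X) * pm (H X))
        = (\<Sum>D \<in> Pow S. \<Sum>X \<in> {X \<in> Pow {..<m}. X \<inter> S = D}. pm (F X) * pm (H X))"
      by (rule sum_fibres[symmetric]) (use finS in auto)
    also have "\<dots> = (\<Sum>D \<in> Pow S. pm (a D > 0) * a D)"
      unfolding a_def sum_distrib_left
      by (intro sum.cong refl) (auto simp: H_def a_def)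
    also have "\<dots> = (\<Sum>D \<in> Pow S. \<bar>a D\<bar>)"
      by (intro sum.cong) (auto simp: pm_def)
    finally show ?thesis by (simp add: fibre_sum_def a_def)
  qed
  then have "2 * real (card {x \<in> cube m. F (ones x) \<noteq> g x}) \<le> 2 * \<epsilon> * 2 ^ m"
    using assms(3)
    by (subst disagreements_eq[where H = H]) (auto simp: g_def ones_bits algebra_simps)
  then have "distance m (\<lambda>x. F (ones x)) g \<le> \<epsilon>"
    by (simp add: distance_eq field_simps)
  ultimately show ?thesis unfolding close_to_junta_def by blast
qed

section \<open>Uniformly random subsets\<close>

lemma sum_Pow_insert:
  assumes "finite U" "x \<notin> U"
  shows "sum f (Pow (insert x U)) = (\<Sum>G \<in> Pow U. f G + f (insert x G))"
proof -
  have "inj_on (insert x) (Pow U)" using assms(2) by (auto simp: inj_on_def)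
  then have "sum f (insert x ` Pow U) = (\<Sum>G \<in> Pow U. f (insert x G))"
    by (simp add: sum.reindex)
  moreover have "Pow U \<inter> insert x ` Pow U = {}" using assms(2) by auto
  ultimately show ?thesis
    using assms(1) by (simp add: Pow_insert sum.union_disjoint sum.distrib)
qed

text \<open>The Efron--Stein inequality, with the second moment written as squared mean plus variance.\<close>
lemma second_moment_lipschitz:
  fixes f :: "'a set \<Rightarrow> real"
  assumes "finite U" "\<And>G x. G \<subseteq> U \<Longrightarrow> x \<in> U \<Longrightarrow> x \<notin> G \<Longrightarrow> \<bar>f (insert x G) - f G\<bar> \<le> c"
  shows "(\<Sum>G \<in> Pow U. (f G)\<^sup>2)
    \<le> 2 ^ card U * (((\<Sum>G \<in> Pow U. f G) / 2 ^ card U)\<^sup>2 + real (card U) * c\<^sup>2 / 4)"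
  using assms
proof (induction U arbitrary: f rule: finite_induct)
  case empty
  then show ?case by simp
next
  case (insert x U)
  define A0 A1 where "A0 = (\<Sum>G \<in> Pow U. f G) / 2 ^ card U"
    and "A1 = (\<Sum>G \<in> Pow U. f (insert x G)) / 2 ^ card U"
  have ins: "\<bar>f (insert x G) - f G\<bar> \<le> c" if "G \<subseteq> U" for G
    using insert.prems[of G x] that insert.hyps by blast
  have "\<bar>A1 - A0\<bar> * 2 ^ card U = \<bar>\<Sum>G \<in> Pow U. f (insert x G) - f G\<bar>"
    by (simp add: A0_def A1_def sum_subtractf diff_divide_distrib[symmetric] abs_divide)
  also have "\<dots> \<le> (\<Sum>G \<in> Pow U. c)"
    by (rule order_trans[OF sum_abs]) (intro sum_mono, use ins in auto)
  finally have "\<bar>A1 - A0\<bar> \<le> c" using insert.hyps by (simp add: card_Pow mult.commute)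
  then have diff: "(A1 - A0)\<^sup>2 \<le> c\<^sup>2" by (simp add: abs_le_square_iff[symmetric])
  have 0: "(\<Sum>G \<in> Pow U. (f G)\<^sup>2) \<le> 2 ^ card U * (A0\<^sup>2 + real (card U) * c\<^sup>2 / 4)"
    unfolding A0_def by (rule insert.IH) (use insert.prems in blast)
  have 1: "(\<Sum>G \<in> Pow U. (f (insert x G))\<^sup>2) \<le> 2 ^ card U * (A1\<^sup>2 + real (card U) * c\<^sup>2 / 4)"
    unfolding A1_def
  proof (rule insert.IH)
    fix G y assume "G \<subseteq> U" "y \<in> U" "y \<notin> G"
    then show "\<bar>f (insert x (insert y G)) - f (insert x G)\<bar> \<le> c"
      using insert.prems[of "insert x G" y] insert.hyps by (auto simp: insert_commute)
  qed
  have mean: "(\<Sum>G \<in> Pow (insert x U). f G) / 2 ^ card (insert x U) = (A0 + A1) / 2"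
    using insert.hyps by (simp add: sum_Pow_insert sum.distrib A0_def A1_def add_divide_distrib mult.commute)
  have "(\<Sum>G \<in> Pow (insert x U). (f G)\<^sup>2)
      \<le> 2 ^ card U * (A0\<^sup>2 + A1\<^sup>2 + 2 * (real (card U) * c\<^sup>2 / 4))"
    using 0 1 insert.hyps by (simp add: sum_Pow_insert sum.distrib algebra_simps)
  \<comment> \<open>The mean of the two squares exceeds the square of the mean by
    \<open>(A1 - A0)\<^sup>2 / 4\<close>, so the new element adds at most
    \<open>c\<^sup>2 / 4\<close> to the variance bound.\<close>
  also have "A0\<^sup>2 + A1\<^sup>2 = 2 * ((A0 + A1) / 2)\<^sup>2 + (A1 - A0)\<^sup>2 / 2"
    by (simp add: power2_eq_square field_simps)
  also have "2 ^ card U * (2 * ((A0 + A1) / 2)\<^sup>2 + (A1 - A0)\<^sup>2 / 2 + 2 * (real (card U) * c\<^sup>2 / 4))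
      \<le> 2 ^ card U * (2 * ((A0 + A1) / 2)\<^sup>2 + c\<^sup>2 / 2 + 2 * (real (card U) * c\<^sup>2 / 4))"
    using diff by (intro mult_left_mono) auto
  also have "\<dots> = 2 ^ card (insert x U) * (((A0 + A1) / 2)\<^sup>2 + real (card (insert x U)) * c\<^sup>2 / 4)"
    using insert.hyps by (simp add: field_simps)
  finally show ?case unfolding mean .
qed

text \<open>Chebyshev's inequality with the Efron--Stein bound \<open>card U * c\<^sup>2 / 4\<close>
  for the variance.\<close>

lemma deviation_lipschitz:
  fixes f :: "'a set \<Rightarrow> real"
  assumes "finite U" "\<And>G x. G \<subseteq> U \<Longrightarrow> x \<in> U \<Longrightarrow> x \<notin> G \<Longrightarrow> \<bar>f (insert x G) - f G\<bar> \<le> c"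
    and "\<mu> = (\<Sum>G \<in> Pow U. f G) / 2 ^ card U" "0 \<le> \<delta>"
  shows "real (card {G \<in> Pow U. \<delta> \<le> \<bar>f G - \<mu>\<bar>}) * \<delta>\<^sup>2 \<le> 2 ^ card U * (real (card U) * c\<^sup>2 / 4)"
proof -
  have sum: "(\<Sum>G \<in> Pow U. f G) = 2 ^ card U * \<mu>" by (simp add: assms(3))
  have "real (card {G \<in> Pow U. \<delta> \<le> \<bar>f G - \<mu>\<bar>}) * \<delta>\<^sup>2
      = (\<Sum>G \<in> {G \<in> Pow U. \<delta> \<le> \<bar>f G - \<mu>\<bar>}. \<delta>\<^sup>2)" by simp
  also have "\<dots> \<le> (\<Sum>G \<in> {G \<in> Pow U. \<delta> \<le> \<bar>f G - \<mu>\<bar>}. (f G - \<mu>)\<^sup>2)"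
    using assms(4) by (intro sum_mono) (auto simp: abs_le_square_iff[symmetric])
  also have "\<dots> \<le> (\<Sum>G \<in> Pow U. (f G - \<mu>)\<^sup>2)"
    using assms(1) by (intro sum_mono2) auto
  also have "\<dots> = (\<Sum>G \<in> Pow U. (f G)\<^sup>2) - 2 ^ card U * \<mu>\<^sup>2"
  proof -
    have "(\<Sum>G \<in> Pow U. (f G - \<mu>)\<^sup>2) = (\<Sum>G \<in> Pow U. (f G)\<^sup>2 - 2 * \<mu> * f G + \<mu>\<^sup>2)"
      by (intro sum.cong) (auto simp: power2_diff)
    also have "\<dots> = (\<Sum>G \<in> Pow U. (f G)\<^sup>2) - 2 * \<mu> * (\<Sum>G \<in> Pow U. f G) + 2 ^ card U * \<mu>\<^sup>2"
      using assms(1) by (simp add: sum.distrib sum_subtractf sum_distrib_left card_Pow)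
    finally show ?thesis by (simp add: sum power2_eq_square)
  qed
  also have "\<dots> \<le> 2 ^ card U * (real (card U) * c\<^sup>2 / 4)"
    using second_moment_lipschitz[OF assms(1,2)] unfolding assms(3)[symmetric]
    by (simp add: algebra_simps)
  finally show ?thesis .
qed

text \<open>A Rademacher sum with coefficients \<open>w\<close>; the random set \<open>G\<close>
  encodes the signs.\<close>

definition signed_sum :: "'a set \<Rightarrow> ('a \<Rightarrow> real) \<Rightarrow> 'a set \<Rightarrow> real" where
  "signed_sum U w G = (\<Sum>x \<in> U. w x * pm (x \<in> G))"

lemma signed_sum_insert:
  assumes "finite U" "x \<notin> U" "G \<subseteq> U"
  shows "signed_sum (insert x U) w G = signed_sum U w G - w x"
    and "signed_sum (insert x U) w (insert x G) = signed_sum U w G + w x"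
proof -
  have "x \<notin> G" using assms by auto
  then show "signed_sum (insert x U) w G = signed_sum U w G - w x"
    using assms by (simp add: signed_sum_def)
  have "(\<Sum>y \<in> U. w y * pm (y \<in> insert x G)) = (\<Sum>y \<in> U. w y * pm (y \<in> G))"
    using assms by (intro sum.cong) (auto simp: pm_def)
  then show "signed_sum (insert x U) w (insert x G) = signed_sum U w G + w x"
    using assms by (simp add: signed_sum_def)
qed

lemma signed_sum_second_moment:
  assumes "finite U"
  shows "(\<Sum>G \<in> Pow U. (signed_sum U w G)\<^sup>2) = 2 ^ card U * (\<Sum>x \<in> U. (w x)\<^sup>2)"
  using assms
proof (induction U rule: finite_induct)
  case empty
  then show ?case by (simp add: signed_sum_def)
next
  case (insert x U)
  have "(\<Sum>G \<in> Pow (insert x U). (signed_sum (insert x U) w G)\<^sup>2)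
      = (\<Sum>G \<in> Pow U. (signed_sum U w G - w x)\<^sup>2 + (signed_sum U w G + w x)\<^sup>2)"
    using insert.hyps by (simp add: sum_Pow_insert signed_sum_insert)
  also have "\<dots> = (\<Sum>G \<in> Pow U. 2 * (signed_sum U w G)\<^sup>2 + 2 * (w x)\<^sup>2)"
    by (intro sum.cong) (auto simp: power2_eq_square algebra_simps)
  also have "\<dots> = 2 ^ card (insert x U) * (\<Sum>x \<in> insert x U. (w x)\<^sup>2)"
    using insert by (simp add: sum.distrib sum_distrib_left[symmetric] card_Pow algebra_simps)
  finally show ?case .
qed

text \<open>When the two signs of \<open>w x\<close> are averaged, the odd powers cancel, and the
  induction leaves \<open>2 * (w x) ^ 4\<close> where the square on the right provides
  \<open>6 * (w x) ^ 4\<close>.\<close>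

lemma signed_sum_fourth_moment:
  assumes "finite U"
  shows "(\<Sum>G \<in> Pow U. (signed_sum U w G) ^ 4) \<le> 2 ^ card U * (3 * (\<Sum>x \<in> U. (w x)\<^sup>2)\<^sup>2)"
  using assms
proof (induction U rule: finite_induct)
  case empty
  then show ?case by (simp add: signed_sum_def)
next
  case (insert x U)
  define Q where "Q = (\<Sum>x \<in> U. (w x)\<^sup>2)"
  have "(\<Sum>G \<in> Pow (insert x U). (signed_sum (insert x U) w G) ^ 4)
      = (\<Sum>G \<in> Pow U. (signed_sum U w G - w x) ^ 4 + (signed_sum U w G + w x) ^ 4)"
    using insert.hyps by (simp add: sum_Pow_insert signed_sum_insert)
  also have "\<dots> = (\<Sum>G \<in> Pow U. 2 * (signed_sum U w G) ^ 4 + 12 * (w x)\<^sup>2 * (signed_sum U w G)\<^sup>2 + 2 * (w x) ^ 4)"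
    by (intro sum.cong) (auto simp: power2_eq_square power4_eq_xxxx algebra_simps)
  also have "\<dots> = 2 * (\<Sum>G \<in> Pow U. (signed_sum U w G) ^ 4) + 12 * (w x)\<^sup>2 * (2 ^ card U * Q) + 2 ^ card U * (2 * (w x) ^ 4)"
    using insert.hyps
    by (simp add: sum.distrib sum_distrib_left[symmetric] card_Pow signed_sum_second_moment Q_def)
  also have "\<dots> \<le> 2 * (2 ^ card U * (3 * Q\<^sup>2)) + 12 * (w x)\<^sup>2 * (2 ^ card U * Q) + 2 ^ card U * (2 * (w x) ^ 4)"
    using insert.IH by (simp add: Q_def)
  also have "\<dots> \<le> 2 ^ card U * (6 * ((w x)\<^sup>2 + Q)\<^sup>2)"
  proof -
    have "6 * ((w x)\<^sup>2 + Q)\<^sup>2 = 6 * Q\<^sup>2 + 12 * (w x)\<^sup>2 * Q + 6 * (w x) ^ 4"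
      by (simp add: power2_eq_square power4_eq_xxxx algebra_simps)
    then have "6 * Q\<^sup>2 + 12 * (w x)\<^sup>2 * Q + 2 * (w x) ^ 4 \<le> 6 * ((w x)\<^sup>2 + Q)\<^sup>2"
      by simp
    from mult_left_mono[OF this, of "2 ^ card U"] show ?thesis by (simp add: algebra_simps)
  qed
  also have "\<dots> = 2 ^ card (insert x U) * (3 * (\<Sum>x \<in> insert x U. (w x)\<^sup>2)\<^sup>2)"
    using insert.hyps by (simp add: Q_def)
  finally show ?case .
qed

text \<open>Khinchine's inequality, from \<open>2\<bar>x\<bar> \<ge> 3x\<^sup>2 - x\<^sup>4\<close> and the two moments above.\<close>
lemma signed_sum_abs_mean:
  assumes "finite U"
  shows "2 ^ card U * sqrt ((\<Sum>x \<in> U. (w x)\<^sup>2) / 3) \<le> (\<Sum>G \<in> Pow U. \<bar>signed_sum U w G\<bar>)"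
proof (cases "(\<Sum>x \<in> U. (w x)\<^sup>2) = 0")
  case True
  then show ?thesis by (simp add: sum_nonneg)
next
  case False
  \<comment> \<open>The scale with \<open>l\<^sup>2 = 3 * Q\<close> maximizes the resulting lower
    bound \<open>(3 * Q / l - 3 * Q\<^sup>2 / l ^ 3) / 2\<close>, whose value is then
    \<open>l / 3\<close>.\<close>
  define Q l where "Q = (\<Sum>x \<in> U. (w x)\<^sup>2)" and "l = sqrt (3 * Q)"
  have Q: "Q > 0" using False sum_nonneg[of U "\<lambda>x. (w x)\<^sup>2"] by (simp add: Q_def order_less_le)
  have l: "l > 0" "l\<^sup>2 = 3 * Q" using Q by (auto simp: l_def)
  have l3: "l / 3 = sqrt (Q / 3)"
  proof -
    have "sqrt (Q / 3) = sqrt (3 * Q / 3\<^sup>2)" by (simp add: power2_eq_square)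
    also have "\<dots> = l / 3" by (simp only: real_sqrt_divide l_def real_sqrt_abs abs_numeral)
    finally show ?thesis by simp
  qed
  have poly: "3 * z\<^sup>2 - z ^ 4 \<le> 2 * \<bar>z\<bar>" for z :: real
  proof -
    have "2 * \<bar>z\<bar> - (3 * z\<^sup>2 - z ^ 4) = \<bar>z\<bar> * ((\<bar>z\<bar> - 1)\<^sup>2 * (\<bar>z\<bar> + 2))"
      by (cases "z \<ge> 0") (auto simp: power2_eq_square power4_eq_xxxx algebra_simps)
    also have "\<dots> \<ge> 0" by simp
    finally show ?thesis by simp
  qed
  have "(3 / l\<^sup>2 * v\<^sup>2 - 1 / l ^ 4 * v ^ 4) * l / 2 \<le> \<bar>v\<bar>" for v
    using poly[of "v / l"] l(1) by (simp add: power_divide field_simps)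
  then have "(\<Sum>G \<in> Pow U. (3 / l\<^sup>2 * (signed_sum U w G)\<^sup>2 - 1 / l ^ 4 * (signed_sum U w G) ^ 4) * l / 2)
      \<le> (\<Sum>G \<in> Pow U. \<bar>signed_sum U w G\<bar>)"
    by (intro sum_mono)
  moreover have "(\<Sum>G \<in> Pow U. (3 / l\<^sup>2 * (signed_sum U w G)\<^sup>2 - 1 / l ^ 4 * (signed_sum U w G) ^ 4) * l / 2)
      = (3 / l\<^sup>2 * (\<Sum>G \<in> Pow U. (signed_sum U w G)\<^sup>2) - 1 / l ^ 4 * (\<Sum>G \<in> Pow U. (signed_sum U w G) ^ 4)) * l / 2"
    by (simp only: sum_divide_distrib[symmetric] sum_distrib_right[symmetric] sum_subtractf sum_distrib_left[symmetric])
  moreover have "\<dots> \<ge> (3 / l\<^sup>2 * (2 ^ card U * Q) - 1 / l ^ 4 * (2 ^ card U * (3 * Q\<^sup>2))) * l / 2"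
    using signed_sum_fourth_moment[OF assms, of w] l(1)
    unfolding signed_sum_second_moment[OF assms] Q_def[symmetric]
    by (intro divide_right_mono mult_right_mono diff_left_mono mult_left_mono) auto
  moreover have "(3 / l\<^sup>2 * (2 ^ card U * Q) - 1 / l ^ 4 * (2 ^ card U * (3 * Q\<^sup>2))) * l / 2 = 2 ^ card U * sqrt (Q / 3)"
  proof -
    have "l ^ 4 = 9 * Q\<^sup>2" using l(2) by (simp add: power4_eq_xxxx power2_eq_square)
    then have "(3 / l\<^sup>2 * (2 ^ card U * Q) - 1 / l ^ 4 * (2 ^ card U * (3 * Q\<^sup>2))) * l / 2 = 2 ^ card U * (l / 3)"
      using Q by (simp add: l(2) field_simps)
    then show ?thesis unfolding l3 .
  qed
  ultimately show ?thesis unfolding Q_def[symmetric] by linarith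
qed

section \<open>Hiding collisions from adaptive queries\<close>

primrec transcript :: "(bool list \<Rightarrow> bool) \<Rightarrow> query_tree \<Rightarrow> (bool list \<times> bool) list" where
  "transcript f (Answer b) = []"
| "transcript f (Query x t0 t1) = (x, f x) # (if f x then transcript f t1 else transcript f t0)"

text \<open>Each query is determined by the earlier answers, so agreement at the points visited on
  \<open>f\<close> forces the same path. This turns an event about an adaptive run into a condition
  on a fixed set of points.\<close>

lemma transcript_eq_iff:
  "transcript g t = transcript f t \<longleftrightarrow> (\<forall>x \<in> fst ` set (transcript f t). g x = f x)"
  by (induction t) auto

lemma accepts_cong_transcript: "transcript g t = transcript f t \<Longrightarrow> accepts g t = accepts f t"
  by (induction t) (auto split: if_splits)

lemma length_transcript: "length (transcript f t) = num_queries f t"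
  by (induction t) auto

lemma transcript_within: "queries_within X t \<Longrightarrow> fst ` set (transcript f t) \<subseteq> X"
  by (induction t) auto

lemma card_Pow_agree:
  assumes "finite U" "D \<subseteq> U"
  shows "card {G \<in> Pow U. \<forall>x \<in> D. (x \<in> G) = v x} = 2 ^ (card U - card D)"
proof -
  have "bij_betw (\<lambda>G. G - D) {G \<in> Pow U. \<forall>x \<in> D. (x \<in> G) = v x} (Pow (U - D))"
    by (rule bij_betw_byWitness[where f' = "\<lambda>H. H \<union> {x \<in> D. v x}"]) (use assms(2) in auto)
  then have "card {G \<in> Pow U. \<forall>x \<in> D. (x \<in> G) = v x} = card (Pow (U - D))"
    by (rule bij_betw_same_card)
  then show ?thesis using assms by (simp add: card_Pow card_Diff_subset finite_subset)
qed

text \<open>\<open>D\<close> holds the queries whose answers depend on \<open>G\<close>. As their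
  keys are distinct, the transcript prescribes \<open>card D\<close> independent memberships. The
  count involves \<open>K\<close> only through \<open>D\<close>, so two key functions with the same
  \<open>D\<close>, both injective on it, give the same count.\<close>

lemma card_same_transcript:
  fixes K :: "bool list \<Rightarrow> 'k" and f :: "bool list \<Rightarrow> bool"
  assumes "finite U" "Q = fst ` set (transcript f t)" "D = {x \<in> Q. K x \<in> U}"
    and "\<And>x. x \<in> Q \<Longrightarrow> f x \<Longrightarrow> K x \<in> U" "inj_on K D"
  shows "card {G \<in> Pow U. transcript (\<lambda>x. K x \<in> G) t = transcript f t} = 2 ^ (card U - card D)"
proof -
  define v where "v y = f (the_inv_into D K y)" for y
  have v: "v (K x) = f x" if "x \<in> D" for x
    using the_inv_into_f_f[OF assms(5) that] by (simp add: v_def)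
  have "(\<forall>x \<in> Q. (K x \<in> G) = f x) \<longleftrightarrow> (\<forall>y \<in> K ` D. (y \<in> G) = v y)" if "G \<subseteq> U" for G
    using that assms(3,4) v by auto
  then have "{G \<in> Pow U. transcript (\<lambda>x. K x \<in> G) t = transcript f t}
      = {G \<in> Pow U. \<forall>y \<in> K ` D. (y \<in> G) = v y}"
    unfolding transcript_eq_iff assms(2)[symmetric] by auto
  also have "card \<dots> = 2 ^ (card U - card (K ` D))"
    by (rule card_Pow_agree[OF assms(1)]) (use assms(3) in auto)
  finally show ?thesis using card_image[OF assms(5)] by simp
qed

lemma few_noninjective:
  fixes K :: "'p \<Rightarrow> 'x \<Rightarrow> 'k" and \<beta> :: real
  assumes "finite \<Phi>" "finite D" "card D \<le> q" "0 \<le> \<beta>"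
    and "\<And>x y. x \<in> D \<Longrightarrow> y \<in> D \<Longrightarrow> x \<noteq> y \<Longrightarrow>
      real (card {\<phi> \<in> \<Phi>. K \<phi> x = K \<phi> y}) \<le> \<beta> * card \<Phi>"
  shows "real (card {\<phi> \<in> \<Phi>. \<not> inj_on (K \<phi>) D}) \<le> (real q)\<^sup>2 * \<beta> * card \<Phi>"
proof -
  let ?P = "{p \<in> D \<times> D. fst p \<noteq> snd p}"
  have finP: "finite ?P" using assms(2) by auto
  have "{\<phi> \<in> \<Phi>. \<not> inj_on (K \<phi>) D} \<subseteq> (\<Union>p \<in> ?P. {\<phi> \<in> \<Phi>. K \<phi> (fst p) = K \<phi> (snd p)})"
    by (auto simp: inj_on_def)
  then have "card {\<phi> \<in> \<Phi>. \<not> inj_on (K \<phi>) D} \<le> card (\<Union>p \<in> ?P. {\<phi> \<in> \<Phi>. K \<phi> (fst p) = K \<phi> (snd p)})"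
    using finP assms(1) by (intro card_mono) auto
  also have "\<dots> \<le> (\<Sum>p \<in> ?P. card {\<phi> \<in> \<Phi>. K \<phi> (fst p) = K \<phi> (snd p)})"
    by (rule card_UN_le[OF finP])
  finally have "real (card {\<phi> \<in> \<Phi>. \<not> inj_on (K \<phi>) D})
      \<le> (\<Sum>p \<in> ?P. real (card {\<phi> \<in> \<Phi>. K \<phi> (fst p) = K \<phi> (snd p)}))"
    unfolding of_nat_sum[symmetric] of_nat_le_iff .
  also have "\<dots> \<le> (\<Sum>p \<in> ?P. \<beta> * card \<Phi>)"
    by (intro sum_mono assms(5)) auto
  also have "\<dots> = real (card ?P) * (\<beta> * card \<Phi>)" by simp
  also have "\<dots> \<le> (real q)\<^sup>2 * (\<beta> * card \<Phi>)"
  proof (rule mult_right_mono)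
    have "card ?P \<le> card (D \<times> D)" using assms(2) by (intro card_mono) auto
    also have "\<dots> \<le> q * q" using assms(3) by (simp add: card_cartesian_product mult_le_mono)
    finally show "real (card ?P) \<le> (real q)\<^sup>2"
      by (simp add: power2_eq_square flip: of_nat_mult)
  qed (use assms(4) in auto)
  finally show ?thesis by (simp add: mult.assoc)
qed

text \<open>Rejecting runs are counted transcript by transcript. For a transcript
  \<open>\<tau>\<close> of the model with \<open>K0\<close>, the set \<open>D\<close> of informative
  queries is fixed, at most a fraction \<open>(real q)\<^sup>2 * \<beta>\<close> of the
  \<open>\<phi>\<close> identify two of its points, and every other \<open>\<phi>\<close> gives
  \<open>\<tau>\<close> for as many \<open>G\<close> as \<open>K0\<close> does. Further rejecting
  runs of the hidden model are discarded, which a one-sided estimate permits.\<close>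

lemma tree_indistinguishable:
  fixes K0 :: "bool list \<Rightarrow> 'k" and K :: "'p \<Rightarrow> bool list \<Rightarrow> 'k" and \<beta> :: real
  assumes "finite U" "finite \<Phi>" "0 \<le> \<beta>"
    and "queries_within X t" "\<And>f. num_queries f t \<le> q" "inj_on K0 X"
    and keyU: "\<And>\<phi> x. \<phi> \<in> \<Phi> \<Longrightarrow> x \<in> X \<Longrightarrow> K \<phi> x \<in> U \<longleftrightarrow> K0 x \<in> U"
    and coll: "\<And>x y. x \<in> X \<Longrightarrow> y \<in> X \<Longrightarrow> x \<noteq> y \<Longrightarrow>
      real (card {\<phi> \<in> \<Phi>. K \<phi> x = K \<phi> y}) \<le> \<beta> * card \<Phi>"
  shows "(1 - (real q)\<^sup>2 * \<beta>) * card \<Phi> * card {G \<in> Pow U. \<not> accepts (\<lambda>x. K0 x \<in> G) t}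
    \<le> (\<Sum>\<phi> \<in> \<Phi>. real (card {G \<in> Pow U. \<not> accepts (\<lambda>x. K \<phi> x \<in> G) t}))"
proof -
  define tr0 where "tr0 G = transcript (\<lambda>x. K0 x \<in> G) t" for G
  define tr where "tr \<phi> G = transcript (\<lambda>x. K \<phi> x \<in> G) t" for \<phi> G
  define B0 where "B0 = {G \<in> Pow U. \<not> accepts (\<lambda>x. K0 x \<in> G) t}"
  have finB0: "finite B0" using assms(1) by (auto simp: B0_def)
  have per_transcript: "(1 - (real q)\<^sup>2 * \<beta>) * card \<Phi> * card {G \<in> B0. tr0 G = \<tau>}
      \<le> (\<Sum>\<phi> \<in> \<Phi>. real (card {G \<in> Pow U. tr \<phi> G = \<tau>}))" if "\<tau> \<in> tr0 ` B0" for \<tau>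
  proof -
    from that obtain G0 where G0: "G0 \<in> B0" "\<tau> = tr0 G0" by auto
    define f where "f x \<longleftrightarrow> K0 x \<in> G0" for x
    have \<tau>: "\<tau> = transcript f t" by (simp add: G0 f_def[abs_def] tr0_def)
    define Q where "Q = fst ` set (transcript f t)"
    define D where "D = {x \<in> Q. K0 x \<in> U}"
    have QX: "Q \<subseteq> X" unfolding Q_def by (rule transcript_within[OF assms(4)])
    have fU: "K0 x \<in> U" if "f x" for x using that G0 by (auto simp: f_def B0_def)
    have "card {G \<in> Pow U. tr0 G = \<tau>} = 2 ^ (card U - card D)"
      unfolding tr0_def \<tau>
      by (rule card_same_transcript[OF assms(1) Q_def D_def])
         (use fU QX assms(6) in \<open>auto simp: D_def intro: inj_on_subset\<close>)
    moreover have "{G \<in> B0. tr0 G = \<tau>} \<subseteq> {G \<in> Pow U. tr0 G = \<tau>}" by (auto simp: B0_def)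
    then have "card {G \<in> B0. tr0 G = \<tau>} \<le> card {G \<in> Pow U. tr0 G = \<tau>}"
      using assms(1) by (intro card_mono) auto
    ultimately have le: "real (card {G \<in> B0. tr0 G = \<tau>}) \<le> 2 ^ (card U - card D)"
      by (metis of_nat_le_iff of_nat_numeral of_nat_power)
    have good: "card {G \<in> Pow U. tr \<phi> G = \<tau>} = 2 ^ (card U - card D)"
      if "\<phi> \<in> \<Phi>" "inj_on (K \<phi>) D" for \<phi>
      unfolding tr_def \<tau>
    proof (rule card_same_transcript[OF assms(1) Q_def _ _ that(2)])
      show "D = {x \<in> Q. K \<phi> x \<in> U}" using keyU[OF that(1)] QX by (auto simp: D_def)
      show "K \<phi> x \<in> U" if "x \<in> Q" "f x" for x using fU keyU[OF \<open>\<phi> \<in> \<Phi>\<close>] that QX by auto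
    qed
    have finD: "finite D" by (auto simp: D_def Q_def)
    have "card D \<le> card Q" by (intro card_mono) (auto simp: D_def Q_def)
    also have "\<dots> \<le> length (transcript f t)"
      unfolding Q_def by (rule order_trans[OF card_image_le]) (auto simp: card_length)
    also have "\<dots> \<le> q" using assms(5) by (simp add: length_transcript)
    finally have cD: "card D \<le> q" .
    have "real (card {\<phi> \<in> \<Phi>. \<not> inj_on (K \<phi>) D}) \<le> (real q)\<^sup>2 * \<beta> * card \<Phi>"
      using coll QX by (intro few_noninjective assms finD cD) (auto simp: D_def)
    moreover have "card {\<phi> \<in> \<Phi>. inj_on (K \<phi>) D} + card {\<phi> \<in> \<Phi>. \<not> inj_on (K \<phi>) D} = card \<Phi>"
    proof -
      have "card ({\<phi> \<in> \<Phi>. inj_on (K \<phi>) D} \<union> {\<phi> \<in> \<Phi>. \<not> inj_on (K \<phi>) D})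
          = card {\<phi> \<in> \<Phi>. inj_on (K \<phi>) D} + card {\<phi> \<in> \<Phi>. \<not> inj_on (K \<phi>) D}"
        using assms(2) by (intro card_Un_disjoint) auto
      moreover have "{\<phi> \<in> \<Phi>. inj_on (K \<phi>) D} \<union> {\<phi> \<in> \<Phi>. \<not> inj_on (K \<phi>) D} = \<Phi>" by auto
      ultimately show ?thesis by simp
    qed
    then have "real (card {\<phi> \<in> \<Phi>. inj_on (K \<phi>) D}) + real (card {\<phi> \<in> \<Phi>. \<not> inj_on (K \<phi>) D}) = real (card \<Phi>)"
      by (simp flip: of_nat_add)
    ultimately have many: "(1 - (real q)\<^sup>2 * \<beta>) * card \<Phi> \<le> real (card {\<phi> \<in> \<Phi>. inj_on (K \<phi>) D})"
      by (simp add: algebra_simps)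
    have "(1 - (real q)\<^sup>2 * \<beta>) * card \<Phi> * card {G \<in> B0. tr0 G = \<tau>}
        \<le> real (card {\<phi> \<in> \<Phi>. inj_on (K \<phi>) D}) * card {G \<in> B0. tr0 G = \<tau>}"
      using many by (intro mult_right_mono) auto
    also have "\<dots> \<le> real (card {\<phi> \<in> \<Phi>. inj_on (K \<phi>) D}) * 2 ^ (card U - card D)"
      using le by (intro mult_left_mono) auto
    also have "\<dots> = (\<Sum>\<phi> \<in> {\<phi> \<in> \<Phi>. inj_on (K \<phi>) D}. real (card {G \<in> Pow U. tr \<phi> G = \<tau>}))"
      using good by simp
    also have "\<dots> \<le> (\<Sum>\<phi> \<in> \<Phi>. real (card {G \<in> Pow U. tr \<phi> G = \<tau>}))"
      using assms(2) by (intro sum_mono2) auto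
    finally show ?thesis .
  qed
  have "(1 - (real q)\<^sup>2 * \<beta>) * card \<Phi> * card B0
      = (\<Sum>\<tau> \<in> tr0 ` B0. (1 - (real q)\<^sup>2 * \<beta>) * card \<Phi> * card {G \<in> B0. tr0 G = \<tau>})"
  proof -
    have "card B0 = (\<Sum>\<tau> \<in> tr0 ` B0. card {G \<in> B0. tr0 G = \<tau>})"
      using sum.group[of B0 "tr0 ` B0" tr0 "\<lambda>_. 1::nat"] finB0 by simp
    then show ?thesis by (simp add: sum_distrib_left)
  qed
  also have "\<dots> \<le> (\<Sum>\<tau> \<in> tr0 ` B0. \<Sum>\<phi> \<in> \<Phi>. real (card {G \<in> Pow U. tr \<phi> G = \<tau>}))"
    by (intro sum_mono per_transcript)
  also have "\<dots> = (\<Sum>\<phi> \<in> \<Phi>. \<Sum>\<tau> \<in> tr0 ` B0. real (card {G \<in> Pow U. tr \<phi> G = \<tau>}))"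
    by (rule sum.swap)
  also have "\<dots> \<le> (\<Sum>\<phi> \<in> \<Phi>. real (card {G \<in> Pow U. \<not> accepts (\<lambda>x. K \<phi> x \<in> G) t}))"
  proof (rule sum_mono)
    fix \<phi>
    have "(\<Sum>\<tau> \<in> tr0 ` B0. card {G \<in> Pow U. tr \<phi> G = \<tau>}) = card (\<Union>\<tau> \<in> tr0 ` B0. {G \<in> Pow U. tr \<phi> G = \<tau>})"
      using finB0 assms(1) by (intro card_UN_disjoint[symmetric]) auto
    also have "\<dots> \<le> card {G \<in> Pow U. \<not> accepts (\<lambda>x. K \<phi> x \<in> G) t}"
    proof (rule card_mono)
      show "(\<Union>\<tau> \<in> tr0 ` B0. {G \<in> Pow U. tr \<phi> G = \<tau>}) \<subseteq> {G \<in> Pow U. \<not> accepts (\<lambda>x. K \<phi> x \<in> G) t}"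
      proof
        fix G assume "G \<in> (\<Union>\<tau> \<in> tr0 ` B0. {G \<in> Pow U. tr \<phi> G = \<tau>})"
        then obtain G0 where "G0 \<in> B0" "G \<in> Pow U" "tr \<phi> G = tr0 G0" by auto
        then show "G \<in> {G \<in> Pow U. \<not> accepts (\<lambda>x. K \<phi> x \<in> G) t}"
          using accepts_cong_transcript[of "\<lambda>x. K \<phi> x \<in> G" t "\<lambda>x. K0 x \<in> G0"]
          by (auto simp: B0_def tr_def tr0_def)
      qed
    qed (use assms(1) in auto)
    finally show "(\<Sum>\<tau> \<in> tr0 ` B0. real (card {G \<in> Pow U. tr \<phi> G = \<tau>}))
        \<le> real (card {G \<in> Pow U. \<not> accepts (\<lambda>x. K \<phi> x \<in> G) t})"
      by (simp flip: of_nat_sum)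
  qed
  finally show ?thesis by (simp add: B0_def)
qed

lemma sum_prob_eq_expectation_card:
  assumes "finite I"
  shows "(\<Sum>i \<in> I. measure_pmf.prob T {t. P i t}) = measure_pmf.expectation T (\<lambda>t. real (card {i \<in> I. P i t}))"
proof -
  have "(\<Sum>i \<in> I. measure_pmf.prob T {t. P i t}) = (\<Sum>i \<in> I. measure_pmf.expectation T (indicator {t. P i t}))"
    by simp
  also have "\<dots> = measure_pmf.expectation T (\<lambda>t. \<Sum>i \<in> I. indicator {t. P i t} t)"
    by (rule Bochner_Integration.integral_sum[symmetric])
       (rule measure_pmf.integrable_const_bound[where B = 1], auto)
  also have "(\<lambda>t. \<Sum>i \<in> I. indicator {t. P i t} t) = (\<lambda>t. real (card {i \<in> I. P i t}))"
    using assms by (auto simp: indicator_def Int_def)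
  finally show ?thesis .
qed

lemma integrable_card_pmf:
  assumes "finite I"
  shows "integrable (measure_pmf T) (\<lambda>t. real (card {i \<in> I. P i t}))"
proof (rule measure_pmf.integrable_const_bound[where B = "real (card I)"])
  have "card {i \<in> I. P i t} \<le> card I" for t using assms by (intro card_mono) auto
  then show "AE t in measure_pmf T. norm (real (card {i \<in> I. P i t})) \<le> real (card I)" by simp
qed simp

text \<open>Rejection probabilities are averaged over \<open>G\<close>, and over
  \<open>\<phi>\<close> in the close model. The average is at least
  \<open>2 / 3 * 9 / 10 = 3 / 5\<close> in the far model and at most
  \<open>1 / 3 + 1 / 10 = 13 / 30\<close> in the close one. If the collision term were at most
  \<open>1 / 4\<close>, the previous comparison would give the close model at least
  \<open>3 / 4 * 3 / 5 = 9 / 20\<close>, which is too much.\<close>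

lemma tester_lower_bound:
  fixes K0 :: "bool list \<Rightarrow> 'k" and K :: "'p \<Rightarrow> bool list \<Rightarrow> 'k" and \<beta> :: real
  assumes T: "tolerant_junta_tester m k \<epsilon>1 \<epsilon>2 T" "makes_at_most q T"
    and fin: "finite U" "finite \<Phi>" "\<Phi> \<noteq> {}" and "0 \<le> \<beta>" "inj_on K0 (cube m)"
    and keyU: "\<And>\<phi> x. \<phi> \<in> \<Phi> \<Longrightarrow> x \<in> cube m \<Longrightarrow> K \<phi> x \<in> U \<longleftrightarrow> K0 x \<in> U"
    and coll: "\<And>x y. x \<in> cube m \<Longrightarrow> y \<in> cube m \<Longrightarrow> x \<noteq> y \<Longrightarrow>
      real (card {\<phi> \<in> \<Phi>. K \<phi> x = K \<phi> y}) \<le> \<beta> * card \<Phi>"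
    and far: "real (card {G \<in> Pow U. \<not> far_from_juntas m k \<epsilon>2 (\<lambda>x. K0 x \<in> G)}) \<le> 2 ^ card U / 10"
    and close: "\<And>\<phi>. \<phi> \<in> \<Phi> \<Longrightarrow>
      real (card {G \<in> Pow U. \<not> close_to_junta m k \<epsilon>1 (\<lambda>x. K \<phi> x \<in> G)}) \<le> 2 ^ card U / 10"
  shows "1 / 4 < (real q)\<^sup>2 * \<beta>"
proof (rule ccontr)
  assume "\<not> 1 / 4 < (real q)\<^sup>2 * \<beta>"
  then have q: "3 / 4 \<le> 1 - (real q)\<^sup>2 * \<beta>" by simp
  define r where "r f = measure_pmf.prob T {t. \<not> accepts f t}" for f
  have r01: "0 \<le> r f" "r f \<le> 1" for f by (auto simp: r_def)
  have r_far: "2 / 3 \<le> r f" if "far_from_juntas m k \<epsilon>2 f" for f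
    using T(1) that by (simp add: tolerant_junta_tester_def r_def)
  have r_close: "r f \<le> 1 / 3" if "close_to_junta m k \<epsilon>1 f" for f
  proof -
    have "2 / 3 \<le> measure_pmf.prob T {t. accepts f t}"
      using T(1) that by (simp add: tolerant_junta_tester_def)
    moreover have "measure_pmf.prob T {t. \<not> accepts f t} = 1 - measure_pmf.prob T {t. accepts f t}"
      by (subst measure_pmf.prob_compl[symmetric]) (auto intro!: arg_cong[where f = "measure_pmf.prob T"])
    ultimately show ?thesis by (simp add: r_def)
  qed
  have finPow: "finite (Pow U)" using fin by simp
  have split: "card {G \<in> Pow U. P G} + card {G \<in> Pow U. \<not> P G} = 2 ^ card U" for P
  proof -
    have "card ({G \<in> Pow U. P G} \<union> {G \<in> Pow U. \<not> P G}) = card {G \<in> Pow U. P G} + card {G \<in> Pow U. \<not> P G}"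
      using finPow by (intro card_Un_disjoint) auto
    moreover have "{G \<in> Pow U. P G} \<union> {G \<in> Pow U. \<not> P G} = Pow U" by auto
    ultimately show ?thesis using fin by (simp add: card_Pow)
  qed
  have no: "(3 / 5) * 2 ^ card U \<le> (\<Sum>G \<in> Pow U. r (\<lambda>x. K0 x \<in> G))"
  proof -
    let ?F = "\<lambda>G. far_from_juntas m k \<epsilon>2 (\<lambda>x. K0 x \<in> G)"
    have "real (card {G \<in> Pow U. ?F G}) + real (card {G \<in> Pow U. \<not> ?F G}) = 2 ^ card U"
      using arg_cong[OF split[of ?F], of real] by simp
    then have "(3 / 5) * 2 ^ card U \<le> (\<Sum>G \<in> {G \<in> Pow U. ?F G}. 2 / 3 :: real)"
      using far by simp
    also have "\<dots> \<le> (\<Sum>G \<in> {G \<in> Pow U. ?F G}. r (\<lambda>x. K0 x \<in> G))"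
      by (intro sum_mono r_far) auto
    also have "\<dots> \<le> (\<Sum>G \<in> Pow U. r (\<lambda>x. K0 x \<in> G))"
      using finPow r01 by (intro sum_mono2) auto
    finally show ?thesis .
  qed
  have yes: "(\<Sum>G \<in> Pow U. r (\<lambda>x. K \<phi> x \<in> G)) \<le> (13 / 30) * 2 ^ card U" if "\<phi> \<in> \<Phi>" for \<phi>
  proof -
    let ?F = "\<lambda>G. close_to_junta m k \<epsilon>1 (\<lambda>x. K \<phi> x \<in> G)"
    have "(\<Sum>G \<in> Pow U. r (\<lambda>x. K \<phi> x \<in> G)) \<le> (\<Sum>G \<in> Pow U. 1 / 3 + (if \<not> ?F G then 1 else 0))"
    proof (rule sum_mono)
      fix G
      show "r (\<lambda>x. K \<phi> x \<in> G) \<le> 1 / 3 + (if \<not> ?F G then 1 else 0)"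
        using r_close[of "\<lambda>x. K \<phi> x \<in> G"] r01(2)[of "\<lambda>x. K \<phi> x \<in> G"]
        by (cases "?F G") auto
    qed
    also have "\<dots> = (1 / 3) * 2 ^ card U + real (card {G \<in> Pow U. \<not> ?F G})"
      using fin by (simp add: sum.distrib card_Pow sum.If_cases Int_def)
    also have "\<dots> \<le> (13 / 30) * 2 ^ card U" using close[OF that] by simp
    finally show ?thesis .
  qed
  define N0 where "N0 t = real (card {G \<in> Pow U. \<not> accepts (\<lambda>x. K0 x \<in> G) t})" for t
  define N where "N \<phi> t = real (card {G \<in> Pow U. \<not> accepts (\<lambda>x. K \<phi> x \<in> G) t})" for \<phi> t
  have int0: "integrable (measure_pmf T) N0" unfolding N0_def by (rule integrable_card_pmf[OF finPow])
  have int: "integrable (measure_pmf T) (N \<phi>)" for \<phi> unfolding N_def by (rule integrable_card_pmf[OF finPow])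
  have "measure_pmf.expectation T (\<lambda>t. (1 - (real q)\<^sup>2 * \<beta>) * card \<Phi> * N0 t)
      \<le> measure_pmf.expectation T (\<lambda>t. \<Sum>\<phi> \<in> \<Phi>. N \<phi> t)"
  proof (rule integral_mono_AE)
    show "AE t in measure_pmf T. (1 - (real q)\<^sup>2 * \<beta>) * card \<Phi> * N0 t \<le> (\<Sum>\<phi> \<in> \<Phi>. N \<phi> t)"
      unfolding AE_measure_pmf_iff N0_def N_def
    proof
      fix t assume "t \<in> set_pmf T"
      then show "(1 - (real q)\<^sup>2 * \<beta>) * card \<Phi> * card {G \<in> Pow U. \<not> accepts (\<lambda>x. K0 x \<in> G) t}
          \<le> (\<Sum>\<phi> \<in> \<Phi>. real (card {G \<in> Pow U. \<not> accepts (\<lambda>x. K \<phi> x \<in> G) t}))"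
        using T unfolding tolerant_junta_tester_def makes_at_most_def
        by (intro tree_indistinguishable[where X = "cube m"] fin assms(6,7) keyU coll) blast+
    qed
  qed (use int0 int in auto)
  then have "(1 - (real q)\<^sup>2 * \<beta>) * card \<Phi> * (\<Sum>G \<in> Pow U. r (\<lambda>x. K0 x \<in> G))
      \<le> (\<Sum>\<phi> \<in> \<Phi>. \<Sum>G \<in> Pow U. r (\<lambda>x. K \<phi> x \<in> G))"
    unfolding r_def sum_prob_eq_expectation_card[OF finPow] N0_def[symmetric] N_def[symmetric]
    using int by (simp add: Bochner_Integration.integral_sum)
  also have "\<dots> \<le> (\<Sum>\<phi> \<in> \<Phi>. (13 / 30) * 2 ^ card U)"
    by (intro sum_mono yes)
  finally have "(1 - (real q)\<^sup>2 * \<beta>) * card \<Phi> * (\<Sum>G \<in> Pow U. r (\<lambda>x. K0 x \<in> G))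
      \<le> card \<Phi> * ((13 / 30) * 2 ^ card U)" by simp
  moreover have "(3 / 4) * card \<Phi> * ((3 / 5) * 2 ^ card U)
      \<le> (1 - (real q)\<^sup>2 * \<beta>) * card \<Phi> * (\<Sum>G \<in> Pow U. r (\<lambda>x. K0 x \<in> G))"
    using q no by (intro mult_mono) auto
  ultimately have "card \<Phi> * ((9 / 20) * 2 ^ card U) \<le> card \<Phi> * ((13 / 30) * 2 ^ card U :: real)"
    by simp
  moreover have "0 < real (card \<Phi>)" using fin by (simp add: card_gt_0_iff)
  ultimately show False by simp
qed

section \<open>A random function is far from juntas\<close>

lemma fibre_sum_lipschitz:
  assumes "finite P" "finite S"
  shows "\<bar>fibre_sum S P \<sigma> - fibre_sum S P \<sigma>'\<bar> \<le> (\<Sum>X \<in> P. \<bar>\<sigma> X - \<sigma>' X\<bar>)"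
proof -
  let ?a = "\<lambda>\<sigma> D. \<Sum>X \<in> {X \<in> P. X \<inter> S = D}. \<sigma> X"
  have "\<bar>fibre_sum S P \<sigma> - fibre_sum S P \<sigma>'\<bar> = \<bar>\<Sum>D \<in> Pow S. \<bar>?a \<sigma> D\<bar> - \<bar>?a \<sigma>' D\<bar>\<bar>"
    by (simp add: fibre_sum_def sum_subtractf)
  also have "\<dots> \<le> (\<Sum>D \<in> Pow S. \<bar>\<bar>?a \<sigma> D\<bar> - \<bar>?a \<sigma>' D\<bar>\<bar>)" by (rule sum_abs)
  also have "\<dots> \<le> (\<Sum>D \<in> Pow S. \<Sum>X \<in> {X \<in> P. X \<inter> S = D}. \<bar>\<sigma> X - \<sigma>' X\<bar>)"
  proof (rule sum_mono)
    fix D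
    have "\<bar>\<bar>?a \<sigma> D\<bar> - \<bar>?a \<sigma>' D\<bar>\<bar> \<le> \<bar>?a \<sigma> D - ?a \<sigma>' D\<bar>" by (rule abs_triangle_ineq3)
    also have "\<dots> = \<bar>\<Sum>X \<in> {X \<in> P. X \<inter> S = D}. \<sigma> X - \<sigma>' X\<bar>" by (simp add: sum_subtractf)
    also have "\<dots> \<le> (\<Sum>X \<in> {X \<in> P. X \<inter> S = D}. \<bar>\<sigma> X - \<sigma>' X\<bar>)" by (rule sum_abs)
    finally show "\<bar>\<bar>?a \<sigma> D\<bar> - \<bar>?a \<sigma>' D\<bar>\<bar> \<le> (\<Sum>X \<in> {X \<in> P. X \<inter> S = D}. \<bar>\<sigma> X - \<sigma>' X\<bar>)" .
  qed
  also have "\<dots> = (\<Sum>X \<in> P. \<bar>\<sigma> X - \<sigma>' X\<bar>)" by (rule sum_fibres[OF assms])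
  finally show ?thesis .
qed

text \<open>Every point outside \<open>U\<close> is charged its full weight \<open>1\<close>,
  because the fibres of an arbitrary \<open>S\<close> may cut \<open>U\<close> in any way.\<close>

lemma fibre_sum_le:
  assumes "finite P" "finite S" "U \<subseteq> P" "\<And>X. \<bar>\<sigma> X\<bar> \<le> 1"
  shows "fibre_sum S P \<sigma> \<le> real (card (P - U)) + fibre_sum S U \<sigma>"
proof -
  have finU: "finite U" using assms finite_subset by blast
  have "fibre_sum S P \<sigma> \<le> (\<Sum>D \<in> Pow S. (\<Sum>X \<in> {X \<in> P - U. X \<inter> S = D}. 1) + \<bar>\<Sum>X \<in> {X \<in> U. X \<inter> S = D}. \<sigma> X\<bar>)"
    unfolding fibre_sum_def
  proof (rule sum_mono)
    fix D
    have "{X \<in> P. X \<inter> S = D} = {X \<in> P - U. X \<inter> S = D} \<union> {X \<in> U. X \<inter> S = D}" using assms(3) by auto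
    then have "(\<Sum>X \<in> {X \<in> P. X \<inter> S = D}. \<sigma> X)
        = (\<Sum>X \<in> {X \<in> P - U. X \<inter> S = D}. \<sigma> X) + (\<Sum>X \<in> {X \<in> U. X \<inter> S = D}. \<sigma> X)"
      using assms(1) finU by (simp add: sum.union_disjoint disjoint_iff)
    moreover have "\<bar>\<Sum>X \<in> {X \<in> P - U. X \<inter> S = D}. \<sigma> X\<bar> \<le> (\<Sum>X \<in> {X \<in> P - U. X \<inter> S = D}. 1)"
      by (rule order_trans[OF sum_abs]) (intro sum_mono assms(4))
    ultimately show "\<bar>\<Sum>X \<in> {X \<in> P. X \<inter> S = D}. \<sigma> X\<bar>
        \<le> (\<Sum>X \<in> {X \<in> P - U. X \<inter> S = D}. 1) + \<bar>\<Sum>X \<in> {X \<in> U. X \<inter> S = D}. \<sigma> X\<bar>"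
      by linarith
  qed
  also have "\<dots> = (\<Sum>X \<in> P - U. 1) + fibre_sum S U \<sigma>"
    unfolding sum.distrib fibre_sum_def using assms(1,2) by (subst sum_fibres) auto
  finally show ?thesis by simp
qed

text \<open>Cauchy--Schwarz is applied to the \<open>2 ^ card S\<close> fibres and then to the sets
  \<open>G\<close>. Each fibre sum is a Rademacher sum with indicator weights, so its second moment
  is the number of points of \<open>U\<close> in the fibre, and these numbers add up to
  \<open>card U\<close>.\<close>

lemma fibre_sum_random_mean:
  assumes "finite U" "finite S"
  shows "((\<Sum>G \<in> Pow U. fibre_sum S U (\<lambda>X. pm (X \<in> G))) / 2 ^ card U)\<^sup>2 \<le> 2 ^ card S * real (card U)"
proof -
  let ?f = "\<lambda>G. fibre_sum S U (\<lambda>X. pm (X \<in> G))"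
  let ?w = "\<lambda>D X. if X \<inter> S = D then 1 else 0 :: real"
  have inner: "(\<Sum>X \<in> {X \<in> U. X \<inter> S = D}. pm (X \<in> G)) = signed_sum U (?w D) G" for D G
    using assms(1) unfolding signed_sum_def by (intro sum.mono_neutral_cong_left) auto
  have "(\<Sum>G \<in> Pow U. (?f G)\<^sup>2) \<le> (\<Sum>G \<in> Pow U. 2 ^ card S * (\<Sum>D \<in> Pow S. (signed_sum U (?w D) G)\<^sup>2))"
  proof (rule sum_mono)
    fix G
    have "(?f G)\<^sup>2 \<le> (\<Sum>D \<in> Pow S. (\<bar>signed_sum U (?w D) G\<bar>)\<^sup>2) * card (Pow S)"
      unfolding fibre_sum_def inner by (rule sum_squared_le_sum_of_squares)
    then show "(?f G)\<^sup>2 \<le> 2 ^ card S * (\<Sum>D \<in> Pow S. (signed_sum U (?w D) G)\<^sup>2)"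
      using assms(2) by (simp add: card_Pow mult.commute)
  qed
  also have "\<dots> = 2 ^ card S * (\<Sum>D \<in> Pow S. \<Sum>G \<in> Pow U. (signed_sum U (?w D) G)\<^sup>2)"
    unfolding sum_distrib_left[symmetric] by (subst sum.swap) simp
  also have "\<dots> = 2 ^ card S * (\<Sum>D \<in> Pow S. 2 ^ card U * (\<Sum>X \<in> {X \<in> U. X \<inter> S = D}. 1))"
  proof -
    have "(\<Sum>X \<in> U. (?w D X)\<^sup>2) = (\<Sum>X \<in> {X \<in> U. X \<inter> S = D}. 1)" for D
      using assms(1) by (intro sum.mono_neutral_cong_right) auto
    then show ?thesis by (simp only: signed_sum_second_moment[OF assms(1)])
  qed
  also have "\<dots> = 2 ^ card S * (2 ^ card U * real (card U))"
    unfolding sum_distrib_left[symmetric] using assms by (subst sum_fibres) auto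
  finally have sq: "(\<Sum>G \<in> Pow U. (?f G)\<^sup>2) \<le> 2 ^ card S * (2 ^ card U * real (card U))" .
  have "(\<Sum>G \<in> Pow U. ?f G)\<^sup>2 \<le> (\<Sum>G \<in> Pow U. (?f G)\<^sup>2) * card (Pow U)"
    by (rule sum_squared_le_sum_of_squares)
  also have "\<dots> \<le> 2 ^ card S * (2 ^ card U * real (card U)) * card (Pow U)"
    using sq by (intro mult_right_mono) auto
  also have "\<dots> = 2 ^ card S * real (card U) * (2 ^ card U)\<^sup>2"
    using assms(1) by (simp add: card_Pow power2_eq_square)
  finally show ?thesis by (simp add: power_divide divide_le_eq)
qed

text \<open>For one \<open>S\<close> the mean is at most \<open>w = sqrt (2 ^ k * 2 ^ m)\<close>,
  whereas the variance is at most \<open>2 ^ m\<close>, since one membership moves the sum by at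
  most \<open>2\<close>. Chebyshev at distance \<open>w\<close> therefore fails with probability at
  most \<open>2 powr (- k)\<close>, small enough for a union bound over all \<open>S\<close> when
  \<open>m\<close> is only slightly larger than \<open>k\<close>.\<close>

lemma card_random_not_far:
  assumes U: "U \<subseteq> Pow {..<m}" and "k \<le> m"
    and gap: "2 * sqrt (2 ^ k * 2 ^ m) \<le> real (card U) - 2 * \<epsilon> * 2 ^ m"
  shows "real (card {G \<in> Pow U. \<not> far_from_juntas m k \<epsilon> (\<lambda>x. ones x \<in> G)})
    \<le> 2 ^ card U * (real (m choose k) / 2 ^ k)"
proof -
  have finU: "finite U" using U finite_subset by blast
  have cardU: "card U \<le> 2 ^ m" using card_mono[OF _ U] by (simp add: card_Pow)
  define f where "f S G = fibre_sum S U (\<lambda>X. pm (X \<in> G))" for S G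
  define w where "w = sqrt (2 ^ k * 2 ^ m)"
  have w: "w > 0" "w\<^sup>2 = 2 ^ k * 2 ^ m" by (auto simp: w_def)
  define \<S> where "\<S> = {S. S \<subseteq> {..<m} \<and> card S = k}"
  have fin\<S>: "finite \<S>" by (auto simp: \<S>_def)
  have bad: "real (card {G \<in> Pow U. 2 * w < f S G}) \<le> 2 ^ card U / 2 ^ k" if "S \<in> \<S>" for S
  proof -
    have S: "finite S" "card S = k" using that finite_subset by (auto simp: \<S>_def)
    define \<mu> where "\<mu> = (\<Sum>G \<in> Pow U. f S G) / 2 ^ card U"
    have "\<mu>\<^sup>2 \<le> 2 ^ k * real (card U)"
      using fibre_sum_random_mean[OF finU S(1)] by (simp add: \<mu>_def f_def S)
    also have "\<dots> \<le> 2 ^ k * 2 ^ m" using cardU by (simp flip: of_nat_le_iff)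
    finally have "\<mu> \<le> w" unfolding w_def by (rule real_le_rsqrt)
    then have sub: "{G \<in> Pow U. 2 * w < f S G} \<subseteq> {G \<in> Pow U. w \<le> \<bar>f S G - \<mu>\<bar>}" by auto
    have "\<bar>f S (insert Y G) - f S G\<bar> \<le> 2" if "Y \<in> U" "Y \<notin> G" for G Y
    proof -
      have "\<bar>f S (insert Y G) - f S G\<bar> \<le> (\<Sum>X \<in> U. \<bar>pm (X \<in> insert Y G) - pm (X \<in> G)\<bar>)"
        unfolding f_def by (rule fibre_sum_lipschitz[OF finU S(1)])
      also have "\<dots> = (\<Sum>X \<in> {Y}. 2)"
        using that finU by (intro sum.mono_neutral_cong_right) (auto simp: pm_def)
      finally show ?thesis by simp
    qed
    then have "real (card {G \<in> Pow U. w \<le> \<bar>f S G - \<mu>\<bar>}) * w\<^sup>2 \<le> 2 ^ card U * (real (card U) * 2\<^sup>2 / 4)"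
      using w by (intro deviation_lipschitz[OF finU _ \<mu>_def]) auto
    also have "\<dots> \<le> 2 ^ card U * 2 ^ m" using cardU by (simp flip: of_nat_le_iff)
    finally have "real (card {G \<in> Pow U. w \<le> \<bar>f S G - \<mu>\<bar>}) \<le> 2 ^ card U / 2 ^ k"
      by (simp add: w field_simps)
    moreover have "card {G \<in> Pow U. 2 * w < f S G} \<le> card {G \<in> Pow U. w \<le> \<bar>f S G - \<mu>\<bar>}"
      using sub finU by (intro card_mono) auto
    ultimately show ?thesis by linarith
  qed
  have "{G \<in> Pow U. \<not> far_from_juntas m k \<epsilon> (\<lambda>x. ones x \<in> G)} \<subseteq> (\<Union>S \<in> \<S>. {G \<in> Pow U. 2 * w < f S G})"
  proof
    fix G assume G: "G \<in> {G \<in> Pow U. \<not> far_from_juntas m k \<epsilon> (\<lambda>x. ones x \<in> G)}"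
    have "\<exists>S \<in> \<S>. 2 * w < f S G"
    proof (rule ccontr)
      assume "\<not> ?thesis"
      then have le: "f S G \<le> 2 * w" if "S \<in> \<S>" for S using that by force
      have "far_from_juntas m k \<epsilon> (\<lambda>x. ones x \<in> G)"
      proof (rule far_from_juntas_fibre_sum[OF assms(2)])
        fix S assume S: "S \<subseteq> {..<m}" "card S = k"
        then have "fibre_sum S (Pow {..<m}) (\<lambda>X. pm (X \<in> G)) \<le> real (card (Pow {..<m} - U)) + f S G"
          unfolding f_def using U by (intro fibre_sum_le) (auto dest: finite_subset)
        also have "real (card (Pow {..<m} - U)) = 2 ^ m - real (card U)"
          using U finU cardU by (simp add: card_Diff_subset card_Pow of_nat_diff)
        also have "f S G \<le> 2 * w" using le S by (simp add: \<S>_def)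
        finally show "fibre_sum S (Pow {..<m}) (\<lambda>X. pm (X \<in> G)) \<le> (1 - 2 * \<epsilon>) * 2 ^ m"
          using gap by (simp add: w_def algebra_simps)
      qed
      with G show False by blast
    qed
    with G show "G \<in> (\<Union>S \<in> \<S>. {G \<in> Pow U. 2 * w < f S G})" by blast
  qed
  then have "card {G \<in> Pow U. \<not> far_from_juntas m k \<epsilon> (\<lambda>x. ones x \<in> G)}
      \<le> card (\<Union>S \<in> \<S>. {G \<in> Pow U. 2 * w < f S G})"
    using finU fin\<S> by (intro card_mono) auto
  also have "\<dots> \<le> (\<Sum>S \<in> \<S>. card {G \<in> Pow U. 2 * w < f S G})"
    by (rule card_UN_le[OF fin\<S>])
  finally have "real (card {G \<in> Pow U. \<not> far_from_juntas m k \<epsilon> (\<lambda>x. ones x \<in> G)})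
      \<le> (\<Sum>S \<in> \<S>. real (card {G \<in> Pow U. 2 * w < f S G}))"
    unfolding of_nat_sum[symmetric] of_nat_le_iff .
  also have "\<dots> \<le> (\<Sum>S \<in> \<S>. 2 ^ card U / 2 ^ k)" by (intro sum_mono bad)
  also have "\<dots> = real (card \<S>) * (2 ^ card U / 2 ^ k)" by simp
  also have "card \<S> = m choose k" unfolding \<S>_def by (subst n_subsets) auto
  finally show ?thesis by (simp add: mult.commute)
qed

section \<open>Collapsing hidden blocks\<close>

text \<open>
  \<open>A\<close> is a disjoint union of blocks, and \<open>ld\<close> sends each element of \<open>A\<close> to the leader of its block.
  The map \<open>collapse\<close> below identifies exactly the sets that differ by a union of blocks.
\<close>
locale blocks =
  fixes m :: nat and A L :: "nat set" and ld :: "nat \<Rightarrow> nat"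
  assumes A_sub: "A \<subseteq> {..<m}" and L_sub: "L \<subseteq> A"
    and ld_in: "p \<in> A \<Longrightarrow> ld p \<in> L" and ld_id: "l \<in> L \<Longrightarrow> ld l = l"
begin

text \<open>Each bit of a block is xored with the bit of its leader: leaders become
  \<open>0\<close>, and flipping a whole block changes nothing.\<close>

definition collapse :: "nat set \<Rightarrow> nat set" where
  "collapse X = (X - A) \<union> {p \<in> A. (p \<in> X) \<noteq> (ld p \<in> X)}"

lemma collapse_diff: "collapse X - A = X - A"
  by (auto simp: collapse_def)

lemma collapse_subset: "X \<subseteq> {..<m} \<Longrightarrow> collapse X \<subseteq> {..<m}"
  using A_sub by (auto simp: collapse_def)

lemma finite_A: "finite A"
  by (rule finite_subset[OF A_sub]) simp

lemma finite_L: "finite L"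
  by (rule finite_subset[OF L_sub finite_A])

text \<open>The bits of a block relative to its leader survive the collapse. A difference at
  \<open>p\<close> therefore forces a difference at the leader of \<open>p\<close>, and from there
  on the whole block.\<close>

lemma collapse_eq_imp:
  assumes "collapse X = collapse Y" "X \<noteq> Y"
  shows "(X - Y) \<union> (Y - X) \<subseteq> A"
    and "\<exists>l \<in> L. {p \<in> A. ld p = l} \<subseteq> (X - Y) \<union> (Y - X)"
proof -
  have outside: "X - A = Y - A" using assms(1) collapse_diff by metis
  then show "(X - Y) \<union> (Y - X) \<subseteq> A" by blast
  have eq: "((p \<in> X) \<noteq> (ld p \<in> X)) = ((p \<in> Y) \<noteq> (ld p \<in> Y))" if "p \<in> A" for p
    using assms(1) that unfolding collapse_def by blast
  obtain p where p: "p \<in> A" "(p \<in> X) \<noteq> (p \<in> Y)" using assms(2) outside by blast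
  then have "(ld p \<in> X) \<noteq> (ld p \<in> Y)" using eq by blast
  then have "{r \<in> A. ld r = ld p} \<subseteq> (X - Y) \<union> (Y - X)" using eq by fastforce
  then show "\<exists>l \<in> L. {p \<in> A. ld p = l} \<subseteq> (X - Y) \<union> (Y - X)" using ld_in p(1) by blast
qed

text \<open>Two distinct sets with the same collapse differ at some leader, so
  \<open>X \<inter> L\<close> determines \<open>X\<close>. The bound serves as a Lipschitz constant:
  one membership in \<open>G\<close> decides the values of at most this many points.\<close>

lemma card_collapse_preimage: "card {X \<in> Pow {..<m}. collapse X = Y} \<le> 2 ^ card L"
proof -
  have "inj_on (\<lambda>X. X \<inter> L) {X \<in> Pow {..<m}. collapse X = Y}"
  proof (rule inj_onI)
    fix X Z assume "X \<in> {X \<in> Pow {..<m}. collapse X = Y}" "Z \<in> {X \<in> Pow {..<m}. collapse X = Y}"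
      and L: "X \<inter> L = Z \<inter> L"
    then have eq: "collapse X = collapse Z" by simp
    show "X = Z"
    proof (rule ccontr)
      assume "X \<noteq> Z"
      then obtain l where "l \<in> L" "{p \<in> A. ld p = l} \<subseteq> (X - Z) \<union> (Z - X)"
        using collapse_eq_imp(2)[OF eq] by blast
      then show False using L L_sub ld_id by blast
    qed
  qed
  then have "card {X \<in> Pow {..<m}. collapse X = Y} \<le> card (Pow L)"
    using finite_L by (intro card_inj_on_le[where f = "\<lambda>X. X \<inter> L"]) auto
  then show ?thesis using finite_L by (simp add: card_Pow)
qed

lemma fibre_eq:
  assumes "D \<subseteq> {..<m} - A"
  shows "{X \<in> Pow {..<m}. X \<inter> ({..<m} - A) = D} = (\<union>) D ` Pow A"
proof (rule set_eqI)
  fix X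
  have "X \<subseteq> {..<m} \<and> X \<inter> ({..<m} - A) = D \<longleftrightarrow> X = D \<union> (X \<inter> A)"
    using assms A_sub by blast
  moreover have "X = D \<union> (X \<inter> A) \<longleftrightarrow> X \<in> (\<union>) D ` Pow A"
    using assms by blast
  ultimately show "X \<in> {X \<in> Pow {..<m}. X \<inter> ({..<m} - A) = D} \<longleftrightarrow> X \<in> (\<union>) D ` Pow A"
    by simp
qed

lemma card_fibre:
  assumes "D \<subseteq> {..<m} - A"
  shows "card {X \<in> Pow {..<m}. X \<inter> ({..<m} - A) = D} = 2 ^ card A"
proof -
  have "inj_on ((\<union>) D) (Pow A)" using assms by (auto simp: inj_on_def)
  then show ?thesis using finite_A unfolding fibre_eq[OF assms] by (simp add: card_image card_Pow)
qed

text \<open>A collapsed set contains no leader, so inside a fibre only the coordinates in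
  \<open>A - L\<close> are free.\<close>

lemma card_collapse_fibre:
  assumes "D \<subseteq> {..<m} - A"
  shows "card (collapse ` {X \<in> Pow {..<m}. X \<inter> ({..<m} - A) = D}) \<le> 2 ^ (card A - card L)"
proof -
  have "collapse ` {X \<in> Pow {..<m}. X \<inter> ({..<m} - A) = D} \<subseteq> (\<union>) D ` Pow (A - L)"
  proof
    fix Y assume "Y \<in> collapse ` {X \<in> Pow {..<m}. X \<inter> ({..<m} - A) = D}"
    then obtain X where X: "X \<subseteq> {..<m}" "X \<inter> ({..<m} - A) = D" "Y = collapse X" by auto
    then have "X - A = D" by auto
    moreover have "collapse X \<inter> L = {}" using L_sub ld_id by (auto simp: collapse_def)
    ultimately have "Y = D \<union> (Y \<inter> (A - L))" using X(3) collapse_diff[of X] by blast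
    then show "Y \<in> (\<union>) D ` Pow (A - L)" by blast
  qed
  then have "card (collapse ` {X \<in> Pow {..<m}. X \<inter> ({..<m} - A) = D}) \<le> card ((\<union>) D ` Pow (A - L))"
    using finite_A by (intro card_mono) auto
  also have "\<dots> \<le> card (Pow (A - L))" using finite_A by (intro card_image_le) auto
  also have "\<dots> = 2 ^ (card A - card L)"
    using finite_A finite_L L_sub by (simp add: card_Pow card_Diff_subset)
  finally show ?thesis .
qed

end

text \<open>The last hypothesis says that \<open>U\<close> is a union of whole fibres over
  \<open>S\<close>, so the constant part and the random part never meet in a fibre and cannot
  cancel.\<close>

lemma fibre_sum_split:
  assumes "finite P" "finite S" "U \<subseteq> P" "\<And>X. X \<in> P - U \<Longrightarrow> \<sigma> X = -1"
    and "\<And>X Y. X \<in> U \<Longrightarrow> Y \<in> P \<Longrightarrow> X \<inter> S = Y \<inter> S \<Longrightarrow> Y \<in> U"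
  shows "fibre_sum S P \<sigma> = real (card (P - U)) + fibre_sum S U \<sigma>"
proof -
  have "fibre_sum S P \<sigma> = (\<Sum>D \<in> Pow S. (\<Sum>X \<in> {X \<in> P - U. X \<inter> S = D}. 1) + \<bar>\<Sum>X \<in> {X \<in> U. X \<inter> S = D}. \<sigma> X\<bar>)"
    unfolding fibre_sum_def
  proof (rule sum.cong[OF refl])
    fix D
    show "\<bar>\<Sum>X \<in> {X \<in> P. X \<inter> S = D}. \<sigma> X\<bar>
        = (\<Sum>X \<in> {X \<in> P - U. X \<inter> S = D}. 1) + \<bar>\<Sum>X \<in> {X \<in> U. X \<inter> S = D}. \<sigma> X\<bar>"
    proof (cases "{X \<in> U. X \<inter> S = D} = {}")
      case True
      then have "{X \<in> P. X \<inter> S = D} = {X \<in> P - U. X \<inter> S = D}" by auto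
      moreover have "(\<Sum>X \<in> {X \<in> P - U. X \<inter> S = D}. \<sigma> X) = (\<Sum>X \<in> {X \<in> P - U. X \<inter> S = D}. -1)"
        using assms(4) by (intro sum.cong) auto
      ultimately show ?thesis unfolding True by simp
    next
      case False
      then have *: "Y \<in> U" if "Y \<in> P" "Y \<inter> S = D" for Y using assms(5) that by blast
      then have none: "{X \<in> P - U. X \<inter> S = D} = {}" and all: "{X \<in> P. X \<inter> S = D} = {X \<in> U. X \<inter> S = D}"
        using assms(3) by auto
      show ?thesis unfolding none all by simp
    qed
  qed
  also have "\<dots> = (\<Sum>X \<in> P - U. 1) + fibre_sum S U \<sigma>"
    unfolding sum.distrib fibre_sum_def using assms(1,2) by (subst sum_fibres) auto
  finally show ?thesis by simp
qed

context blocks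
begin

context
  fixes U :: "nat set set"
  assumes U_sub: "U \<subseteq> Pow {..<m}"
    and U_inv: "\<And>X Y. X \<in> U \<Longrightarrow> Y \<subseteq> {..<m} \<Longrightarrow> X - A = Y - A \<Longrightarrow> Y \<in> U"
begin

lemma finite_U: "finite U"
  by (rule finite_subset[OF U_sub]) simp

lemma collapse_in_iff: "X \<subseteq> {..<m} \<Longrightarrow> collapse X \<in> U \<longleftrightarrow> X \<in> U"
  using U_inv collapse_diff collapse_subset U_sub by blast

lemma restrict_eq: "X \<subseteq> {..<m} \<Longrightarrow> X \<inter> ({..<m} - A) = X - A"
  by auto

text \<open>On a fibre of \<open>2 ^ card A\<close> points the sum is a Rademacher sum whose weights
  are the sizes of the collapse classes. There are at most \<open>2 ^ (card A - card L)\<close>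
  classes, so by Cauchy--Schwarz the squared weights sum to at least
  \<open>2 ^ (card A + card L)\<close>, and Khinchine's inequality gives the mean. By
  \<open>U_inv\<close> a fibre that meets \<open>U\<close> lies in it.\<close>

lemma collapse_fibre_mean:
  assumes "D \<in> Pow ({..<m} - A)"
  shows "2 ^ card U * (real (card {X \<in> U. X \<inter> ({..<m} - A) = D}) * sqrt (2 ^ card L / (3 * 2 ^ card A)))
    \<le> (\<Sum>G \<in> Pow U. \<bar>\<Sum>X \<in> {X \<in> U. X \<inter> ({..<m} - A) = D}. pm (collapse X \<in> G)\<bar>)"
proof (cases "{X \<in> U. X \<inter> ({..<m} - A) = D} = {}")
  case True
  then show ?thesis by (simp only: sum.empty card.empty) simp
next
  case False
  define F where "F = {X \<in> U. X \<inter> ({..<m} - A) = D}"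
  have F: "F = {X \<in> Pow {..<m}. X \<inter> ({..<m} - A) = D}"
  proof -
    from False obtain X where X: "X \<in> U" "X \<inter> ({..<m} - A) = D" by auto
    have "Y \<in> U" if "Y \<subseteq> {..<m}" "Y \<inter> ({..<m} - A) = D" for Y
    proof (rule U_inv[OF X(1) that(1)])
      show "X - A = Y - A" using X that U_sub restrict_eq by (metis PowD subsetD)
    qed
    then show ?thesis using U_sub by (auto simp: F_def)
  qed
  have cF: "card F = 2 ^ card A" unfolding F using assms by (intro card_fibre) auto
  have cI: "card (collapse ` F) \<le> 2 ^ (card A - card L)"
    unfolding F using assms by (intro card_collapse_fibre) auto
  have finF: "finite F" by (simp add: F)
  have img: "collapse ` F \<subseteq> U" using collapse_in_iff U_sub by (auto simp: F_def)
  define w where "w Y = real (card {X \<in> F. collapse X = Y})" for Y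
  define Q where "Q = (\<Sum>Y \<in> U. (w Y)\<^sup>2)"
  have inner: "(\<Sum>X \<in> F. pm (collapse X \<in> G)) = signed_sum U w G" for G
  proof -
    have "(\<Sum>X \<in> F. pm (collapse X \<in> G)) = (\<Sum>Y \<in> U. \<Sum>X \<in> {X \<in> F. collapse X = Y}. pm (collapse X \<in> G))"
      by (rule sum.group[symmetric, OF finF finite_U img])
    then show ?thesis by (simp add: signed_sum_def w_def)
  qed
  have "(\<Sum>Y \<in> collapse ` F. w Y) = card F"
    unfolding w_def using sum.group[of F "collapse ` F" collapse "\<lambda>_. 1 :: real"] finF by simp
  then have "(2 ^ card A)\<^sup>2 \<le> (\<Sum>Y \<in> collapse ` F. (w Y)\<^sup>2) * card (collapse ` F)"
    using sum_squared_le_sum_of_squares[of w "collapse ` F"] cF by simp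
  also have "\<dots> \<le> Q * 2 ^ (card A - card L)"
  proof (rule mult_mono)
    show "(\<Sum>Y \<in> collapse ` F. (w Y)\<^sup>2) \<le> Q"
      unfolding Q_def using finite_U img by (intro sum_mono2) auto
    show "real (card (collapse ` F)) \<le> 2 ^ (card A - card L)"
      using cI by (metis of_nat_le_iff of_nat_numeral of_nat_power)
  qed (auto simp: Q_def sum_nonneg)
  also have "\<dots> = Q * (2 ^ card A / 2 ^ card L)"
    using card_mono[OF finite_A L_sub] by (simp add: power_diff)
  finally have Q: "2 ^ card A * 2 ^ card L \<le> Q"
    by (simp add: power2_eq_square field_simps)
  have "real (card F) * sqrt (2 ^ card L / (3 * 2 ^ card A)) = sqrt ((2 ^ card A)\<^sup>2 * (2 ^ card L / (3 * 2 ^ card A)))"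
    unfolding real_sqrt_mult by (simp add: cF)
  also have "(2 ^ card A)\<^sup>2 * (2 ^ card L / (3 * 2 ^ card A)) = 2 ^ card A * 2 ^ card L / (3 :: real)"
    by (simp add: power2_eq_square)
  also have "sqrt (2 ^ card A * 2 ^ card L / 3) \<le> sqrt (Q / 3)"
    using Q by (intro real_sqrt_le_mono divide_right_mono) auto
  finally have "2 ^ card U * (real (card F) * sqrt (2 ^ card L / (3 * 2 ^ card A))) \<le> 2 ^ card U * sqrt (Q / 3)"
    by (intro mult_left_mono) auto
  also have "\<dots> \<le> (\<Sum>G \<in> Pow U. \<bar>signed_sum U w G\<bar>)"
    unfolding Q_def by (rule signed_sum_abs_mean[OF finite_U])
  finally show ?thesis by (simp only: inner F_def[symmetric])
qed

lemma close_to_junta_collapse: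
  assumes "m - card A \<le> k" "G \<subseteq> U"
    and "real (card U) - 2 * \<epsilon> * 2 ^ m \<le> fibre_sum ({..<m} - A) U (\<lambda>X. pm (collapse X \<in> G))"
  shows "close_to_junta m k \<epsilon> (\<lambda>x. collapse (ones x) \<in> G)"
proof (rule close_to_junta_fibre_sum)
  have cardU: "card U \<le> 2 ^ m" using card_mono[OF _ U_sub] by (simp add: card_Pow)
  show "card ({..<m} - A) \<le> k" using assms(1) A_sub finite_A by (simp add: card_Diff_subset)
  have "fibre_sum ({..<m} - A) (Pow {..<m}) (\<lambda>X. pm (collapse X \<in> G))
      = real (card (Pow {..<m} - U)) + fibre_sum ({..<m} - A) U (\<lambda>X. pm (collapse X \<in> G))"
  proof (rule fibre_sum_split)
    show "pm (collapse X \<in> G) = -1" if "X \<in> Pow {..<m} - U" for X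
      using that collapse_in_iff assms(2) by (auto simp: pm_def)
    show "Y \<in> U" if "X \<in> U" "Y \<in> Pow {..<m}" "X \<inter> ({..<m} - A) = Y \<inter> ({..<m} - A)" for X Y
    proof (rule U_inv[OF that(1)])
      show "X - A = Y - A" using that U_sub restrict_eq by (metis PowD subsetD)
    qed (use that in auto)
  qed (use U_sub in auto)
  also have "real (card (Pow {..<m} - U)) = 2 ^ m - real (card U)"
    using U_sub finite_U cardU by (simp add: card_Diff_subset card_Pow of_nat_diff)
  finally show "(1 - 2 * \<epsilon>) * 2 ^ m \<le> fibre_sum ({..<m} - A) (Pow {..<m}) (\<lambda>X. pm (collapse X \<in> G))"
    using assms(3) by (simp add: algebra_simps)
qed auto

text \<open>Only the one set of visible coordinates has to work, so no union bound occurs. The mean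
  is at least \<open>card U * \<eta>\<close>, twice the threshold \<open>c\<close>; changing one
  membership moves the sum by at most \<open>2 * 2 ^ card L\<close>, and Chebyshev's inequality
  bounds the exceptions.\<close>

lemma card_random_not_close:
  assumes k: "m - card A \<le> k" and "\<eta> = sqrt (2 ^ card L / (3 * 2 ^ card A))"
    and gap: "real (card U) - 2 * \<epsilon> * 2 ^ m \<le> real (card U) * \<eta> / 2"
  shows "real (card {G \<in> Pow U. \<not> close_to_junta m k \<epsilon> (\<lambda>x. collapse (ones x) \<in> G)}) * card U
    \<le> 2 ^ card U * (12 * 2 ^ (card L + card A))"
proof (cases "card U = 0")
  case False
  let ?B = "real (card {G \<in> Pow U. \<not> close_to_junta m k \<epsilon> (\<lambda>x. collapse (ones x) \<in> G)})"
  define S where "S = {..<m} - A"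
  have finS: "finite S" by (simp add: S_def)
  define f where "f G = fibre_sum S U (\<lambda>X. pm (collapse X \<in> G))" for G
  define \<mu> where "\<mu> = (\<Sum>G \<in> Pow U. f G) / 2 ^ card U"
  define c where "c = real (card U) * \<eta> / 2"
  have \<eta>: "\<eta>\<^sup>2 = 2 ^ card L / (3 * 2 ^ card A)" by (simp add: assms(2))
  have c0: "0 \<le> c" by (simp add: c_def assms(2))
  have "2 ^ card U * (card U * \<eta>) = (\<Sum>D \<in> Pow S. 2 ^ card U * (real (card {X \<in> U. X \<inter> S = D}) * \<eta>))"
  proof -
    have "real (card U) = (\<Sum>D \<in> Pow S. real (card {X \<in> U. X \<inter> S = D}))"
      using sum_fibres[OF finite_U finS, of "\<lambda>_. 1 :: real"] by simp
    then show ?thesis by (simp add: sum_distrib_left sum_distrib_right)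
  qed
  also have "\<dots> \<le> (\<Sum>D \<in> Pow S. \<Sum>G \<in> Pow U. \<bar>\<Sum>X \<in> {X \<in> U. X \<inter> S = D}. pm (collapse X \<in> G)\<bar>)"
    unfolding S_def assms(2) by (intro sum_mono collapse_fibre_mean)
  also have "\<dots> = (\<Sum>G \<in> Pow U. f G)"
    unfolding f_def fibre_sum_def by (rule sum.swap)
  finally have \<mu>: "2 * c \<le> \<mu>" by (simp add: \<mu>_def c_def field_simps)
  have lip: "\<bar>f (insert Y G) - f G\<bar> \<le> 2 * 2 ^ card L" for G Y
  proof -
    have "\<bar>f (insert Y G) - f G\<bar> \<le> (\<Sum>X \<in> U. \<bar>pm (collapse X \<in> insert Y G) - pm (collapse X \<in> G)\<bar>)"
      unfolding f_def by (rule fibre_sum_lipschitz[OF finite_U finS])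
    also have "\<dots> \<le> (\<Sum>X \<in> U. if collapse X = Y then 2 else 0)"
      by (intro sum_mono) (auto simp: pm_def)
    also have "\<dots> = 2 * real (card {X \<in> U. collapse X = Y})"
      using finite_U by (simp add: sum.If_cases Int_def)
    also have "card {X \<in> U. collapse X = Y} \<le> card {X \<in> Pow {..<m}. collapse X = Y}"
      using U_sub by (intro card_mono) auto
    also have "\<dots> \<le> 2 ^ card L" by (rule card_collapse_preimage)
    finally show ?thesis by simp
  qed
  have "{G \<in> Pow U. \<not> close_to_junta m k \<epsilon> (\<lambda>x. collapse (ones x) \<in> G)} \<subseteq> {G \<in> Pow U. c \<le> \<bar>f G - \<mu>\<bar>}"
  proof
    fix G assume G: "G \<in> {G \<in> Pow U. \<not> close_to_junta m k \<epsilon> (\<lambda>x. collapse (ones x) \<in> G)}"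
    have "f G < c"
    proof (rule ccontr)
      assume "\<not> f G < c"
      then have "real (card U) - 2 * \<epsilon> * 2 ^ m \<le> fibre_sum ({..<m} - A) U (\<lambda>X. pm (collapse X \<in> G))"
        using gap by (simp add: c_def f_def S_def)
      then show False using close_to_junta_collapse[OF k] G by auto
    qed
    then show "G \<in> {G \<in> Pow U. c \<le> \<bar>f G - \<mu>\<bar>}" using G \<mu> by auto
  qed
  then have "card {G \<in> Pow U. \<not> close_to_junta m k \<epsilon> (\<lambda>x. collapse (ones x) \<in> G)}
      \<le> card {G \<in> Pow U. c \<le> \<bar>f G - \<mu>\<bar>}"
    using finite_U by (intro card_mono) auto
  then have "?B * c\<^sup>2 \<le> real (card {G \<in> Pow U. c \<le> \<bar>f G - \<mu>\<bar>}) * c\<^sup>2"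
    by (intro mult_right_mono) auto
  also have "\<dots> \<le> 2 ^ card U * (real (card U) * (2 * 2 ^ card L)\<^sup>2 / 4)"
    using lip c0 by (intro deviation_lipschitz[OF finite_U _ \<mu>_def]) auto
  finally have le: "?B * c\<^sup>2 \<le> 2 ^ card U * (real (card U) * (2 ^ card L)\<^sup>2)"
    by (simp add: power_mult_distrib)
  define d where "d = real (card U) * (2 ^ card L / (12 * 2 ^ card A))"
  have "d > 0" using False by (simp add: d_def)
  have "c\<^sup>2 = real (card U) * d"
    by (simp add: c_def d_def power_divide power_mult_distrib \<eta> power2_eq_square[of "real _"])
  then have "?B * real (card U) * d = ?B * c\<^sup>2" by simp
  also note le
  also have "2 ^ card U * (real (card U) * (2 ^ card L)\<^sup>2) = 2 ^ card U * (12 * 2 ^ (card L + card A)) * d"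
    by (simp add: d_def power2_eq_square power_add)
  finally show ?thesis using \<open>d > 0\<close> by (rule mult_right_le_imp_le)
qed simp

text \<open>When each hidden coordinate is its own leader, \<open>collapse\<close> deletes
  \<open>A\<close>, and the function is constant on every fibre.\<close>

lemma close_to_junta_all_leaders:
  assumes "L = A" "m - card A \<le> k" "0 \<le> \<epsilon>" "G \<subseteq> U"
  shows "close_to_junta m k \<epsilon> (\<lambda>x. collapse (ones x) \<in> G)"
proof (rule close_to_junta_collapse[OF assms(2,4)])
  have collapse: "collapse X = X - A" for X using ld_id assms(1) by (auto simp: collapse_def)
  have "fibre_sum ({..<m} - A) U (\<lambda>X. pm (collapse X \<in> G))
      = (\<Sum>D \<in> Pow ({..<m} - A). \<Sum>X \<in> {X \<in> U. X \<inter> ({..<m} - A) = D}. 1)"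
    unfolding fibre_sum_def
  proof (rule sum.cong[OF refl])
    fix D
    have "(\<Sum>X \<in> {X \<in> U. X \<inter> ({..<m} - A) = D}. pm (collapse X \<in> G))
        = (\<Sum>X \<in> {X \<in> U. X \<inter> ({..<m} - A) = D}. pm (D \<in> G))"
    proof (rule sum.cong[OF refl])
      fix X assume "X \<in> {X \<in> U. X \<inter> ({..<m} - A) = D}"
      then have "X - A = D" using restrict_eq[of X] U_sub by auto
      then show "pm (collapse X \<in> G) = pm (D \<in> G)" by (simp add: collapse)
    qed
    then show "\<bar>\<Sum>X \<in> {X \<in> U. X \<inter> ({..<m} - A) = D}. pm (collapse X \<in> G)\<bar>
        = (\<Sum>X \<in> {X \<in> U. X \<inter> ({..<m} - A) = D}. 1)"
      by (simp add: abs_mult)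
  qed
  also have "\<dots> = real (card U)" using finite_U by (subst sum_fibres) auto
  finally show "real (card U) - 2 * \<epsilon> * 2 ^ m \<le> fibre_sum ({..<m} - A) U (\<lambda>X. pm (collapse X \<in> G))"
    using assms(3) by simp
qed

end

end

section \<open>Hidden positions\<close>

text \<open>
  Past the first \<open>s\<close> coordinates there are \<open>j * t\<close> bins of \<open>b\<close> coordinates each, and \<open>\<phi>\<close> hides one
  coordinate in every bin.  The hidden coordinates of the bins in one residue class modulo \<open>j\<close> form
  a block, so there are \<open>j\<close> blocks of size \<open>t\<close>.
\<close>
locale hidden =
  fixes m s b j t :: nat
  assumes pos: "0 < b" "0 < j" "0 < t" and fits: "s + b * (j * t) \<le> m"
begin

definition loc :: "(nat \<Rightarrow> nat) \<Rightarrow> nat \<Rightarrow> nat" where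
  "loc \<phi> i = s + b * i + \<phi> i"

definition hid :: "(nat \<Rightarrow> nat) \<Rightarrow> nat set" where
  "hid \<phi> = loc \<phi> ` {..<j * t}"

definition leaders :: "(nat \<Rightarrow> nat) \<Rightarrow> nat set" where
  "leaders \<phi> = loc \<phi> ` {..<j}"

definition leader :: "(nat \<Rightarrow> nat) \<Rightarrow> nat \<Rightarrow> nat" where
  "leader \<phi> p = loc \<phi> (((p - s) div b) mod j)"

definition choices :: "(nat \<Rightarrow> nat) set" where
  "choices = PiE {..<j * t} (\<lambda>_. {..<b})"

lemma finite_choices: "finite choices" and card_choices: "card choices = b ^ (j * t)"
  by (auto simp: choices_def finite_PiE card_PiE)

lemma choices_nonempty: "choices \<noteq> {}"
  using card_choices pos by force

lemma j_le: "j \<le> j * t"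
  using pos by simp

lemma bin_loc: "\<phi> \<in> choices \<Longrightarrow> i < j * t \<Longrightarrow> (loc \<phi> i - s) div b = i"
  using pos by (simp add: loc_def choices_def PiE_def Pi_def)

lemma inj_on_loc: "\<phi> \<in> choices \<Longrightarrow> inj_on (loc \<phi>) {..<j * t}"
  by (metis bin_loc inj_onI lessThan_iff)

lemma card_hid: "\<phi> \<in> choices \<Longrightarrow> card (hid \<phi>) = j * t"
  by (simp add: hid_def card_image inj_on_loc)

lemma card_leaders: "\<phi> \<in> choices \<Longrightarrow> card (leaders \<phi>) = j"
  unfolding leaders_def by (subst card_image) (auto intro: inj_on_subset[OF inj_on_loc] simp: j_le less_le_trans[OF _ j_le])

lemma leader_loc: "\<phi> \<in> choices \<Longrightarrow> i < j * t \<Longrightarrow> leader \<phi> (loc \<phi> i) = loc \<phi> (i mod j)"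
  by (simp add: leader_def bin_loc)

lemma hid_ge: "p \<in> hid \<phi> \<Longrightarrow> s \<le> p"
  by (auto simp: hid_def loc_def)

lemma hid_subset:
  assumes "\<phi> \<in> choices"
  shows "hid \<phi> \<subseteq> {..<m}"
proof
  fix p assume "p \<in> hid \<phi>"
  then obtain i where i: "i < j * t" "p = loc \<phi> i" by (auto simp: hid_def)
  have "\<phi> i < b" using assms i by (auto simp: choices_def)
  then have "p < s + b * (i + 1)" by (simp add: i loc_def)
  also have "\<dots> \<le> s + b * (j * t)" using i(1) by (intro add_left_mono mult_left_mono) auto
  finally show "p \<in> {..<m}" using fits by simp
qed

lemma blocks_hidden:
  assumes "\<phi> \<in> choices"
  shows "blocks m (hid \<phi>) (leaders \<phi>) (leader \<phi>)"
proof
  show "hid \<phi> \<subseteq> {..<m}" by (rule hid_subset[OF assms])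
  show "leaders \<phi> \<subseteq> hid \<phi>" unfolding leaders_def hid_def
    by (intro image_mono) (simp only: lessThan_subset_iff j_le)
  show "leader \<phi> p \<in> leaders \<phi>" if "p \<in> hid \<phi>" for p
    using that pos leader_loc[OF assms] by (auto simp: hid_def leaders_def)
  show "leader \<phi> l = l" if l: "l \<in> leaders \<phi>" for l
  proof -
    from l obtain i where "i < j" "l = loc \<phi> i" by (auto simp: leaders_def)
    then show ?thesis using leader_loc[OF assms, of i] less_le_trans[OF _ j_le] by simp
  qed
qed

definition key :: "(nat \<Rightarrow> nat) \<Rightarrow> nat set \<Rightarrow> nat set" where
  "key \<phi> = blocks.collapse (hid \<phi>) (leader \<phi>)"

lemma key_collision:
  assumes "\<phi> \<in> choices" "key \<phi> X = key \<phi> Y" "X \<noteq> Y"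
  shows "(X - Y) \<union> (Y - X) \<subseteq> hid \<phi>"
    and "t \<le> card {i \<in> {..<j * t}. loc \<phi> i \<in> (X - Y) \<union> (Y - X)}"
proof -
  interpret blocks m "hid \<phi>" "leaders \<phi>" "leader \<phi>" by (rule blocks_hidden[OF assms(1)])
  have eq: "collapse X = collapse Y" using assms(2) by (simp add: key_def)
  show "(X - Y) \<union> (Y - X) \<subseteq> hid \<phi>" by (rule collapse_eq_imp(1)[OF eq assms(3)])
  obtain l where "l \<in> leaders \<phi>" and l: "{p \<in> hid \<phi>. leader \<phi> p = l} \<subseteq> (X - Y) \<union> (Y - X)"
    using collapse_eq_imp(2)[OF eq assms(3)] by blast
  then obtain i where i: "i < j" "l = loc \<phi> i" by (auto simp: leaders_def)
  \<comment> \<open>The bins \<open>i\<close>, \<open>i + j\<close>, \<open>i + 2 * j\<close>, ...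
    are those whose hidden coordinates form the block led by \<open>l\<close>.\<close>
  have "(\<lambda>u. u * j + i) ` {..<t} \<subseteq> {i \<in> {..<j * t}. loc \<phi> i \<in> (X - Y) \<union> (Y - X)}"
  proof
    fix r assume "r \<in> (\<lambda>u. u * j + i) ` {..<t}"
    then obtain u where u: "u < t" "r = u * j + i" by auto
    have "u * j + i < (u + 1) * j" using i(1) by simp
    also have "\<dots> \<le> t * j" using u(1) by (intro mult_right_mono) auto
    finally have r: "r < j * t" by (simp add: u mult.commute)
    have "leader \<phi> (loc \<phi> r) = l" using leader_loc[OF assms(1) r] i by (simp add: u)
    then have "loc \<phi> r \<in> {p \<in> hid \<phi>. leader \<phi> p = l}" using r by (auto simp: hid_def)
    then show "r \<in> {i \<in> {..<j * t}. loc \<phi> i \<in> (X - Y) \<union> (Y - X)}" using l r by blast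
  qed
  then have "card ((\<lambda>u. u * j + i) ` {..<t}) \<le> card {i \<in> {..<j * t}. loc \<phi> i \<in> (X - Y) \<union> (Y - X)}"
    by (intro card_mono) auto
  moreover have "inj_on (\<lambda>u. u * j + i) {..<t}" using pos by (auto simp: inj_on_def)
  ultimately show "t \<le> card {i \<in> {..<j * t}. loc \<phi> i \<in> (X - Y) \<union> (Y - X)}"
    by (simp add: card_image)
qed

text \<open>
  If \<open>X\<close> and \<open>Y\<close> collide, then their difference contains a block and no other than hidden
  coordinates, so it reveals the hidden coordinate of at least \<open>t\<close> bins.
\<close>
lemma card_key_collision:
  assumes "X \<noteq> Y"
  shows "real (card {\<phi> \<in> choices. key \<phi> X = key \<phi> Y}) \<le> 1 / real b ^ t * card choices"
proof (cases "\<exists>\<psi> \<in> choices. key \<psi> X = key \<psi> Y")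
  case False
  then have "{\<phi> \<in> choices. key \<phi> X = key \<phi> Y} = {}" by blast
  then show ?thesis by (simp only: card.empty) simp
next
  case True
  then obtain \<psi> where \<psi>: "\<psi> \<in> choices" "key \<psi> X = key \<psi> Y" by blast
  define I where "I = {i \<in> {..<j * t}. loc \<psi> i \<in> (X - Y) \<union> (Y - X)}"
  have I: "I \<subseteq> {..<j * t}" "t \<le> card I"
    using key_collision(2)[OF \<psi> assms] by (auto simp: I_def)
  \<comment> \<open>The coordinate that \<open>\<psi>\<close> hides in bin \<open>i\<close> lies in
    the difference of \<open>X\<close> and \<open>Y\<close>, so a colliding \<open>\<phi>\<close>
    must hide it as well, and a coordinate determines its bin.\<close>
  have agree: "\<phi> i = \<psi> i" if \<phi>: "\<phi> \<in> choices" "key \<phi> X = key \<phi> Y" and i: "i \<in> I" for \<phi> i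
  proof -
    have "loc \<psi> i \<in> hid \<phi>" using key_collision(1)[OF \<phi> assms] i by (auto simp: I_def)
    then obtain i' where i': "i' < j * t" "loc \<psi> i = loc \<phi> i'" by (auto simp: hid_def)
    have "i = i'" using bin_loc[OF \<psi>(1), of i] bin_loc[OF \<phi>(1) i'(1)] i i' I(1) by auto
    then show ?thesis using i'(2) by (simp add: loc_def)
  qed
  have "inj_on (\<lambda>\<phi>. restrict \<phi> ({..<j * t} - I)) {\<phi> \<in> choices. key \<phi> X = key \<phi> Y}"
  proof (rule inj_onI)
    fix \<phi> \<phi>' assume \<phi>: "\<phi> \<in> {\<phi> \<in> choices. key \<phi> X = key \<phi> Y}" and \<phi>': "\<phi>' \<in> {\<phi> \<in> choices. key \<phi> X = key \<phi> Y}"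
      and eq: "restrict \<phi> ({..<j * t} - I) = restrict \<phi>' ({..<j * t} - I)"
    show "\<phi> = \<phi>'"
    proof (rule PiE_ext[where k = "{..<j * t}" and s = "\<lambda>_. {..<b}"])
      show "\<phi> \<in> PiE {..<j * t} (\<lambda>_. {..<b})" "\<phi>' \<in> PiE {..<j * t} (\<lambda>_. {..<b})"
        using \<phi> \<phi>' by (auto simp: choices_def)
      show "\<phi> i = \<phi>' i" if "i \<in> {..<j * t}" for i
      proof (cases "i \<in> I")
        case True
        then show ?thesis using agree[of \<phi> i] agree[of \<phi>' i] \<phi> \<phi>' by simp
      next
        case False
        then show ?thesis using fun_cong[OF eq, of i] that by simp
      qed
    qed
  qed
  then have "card {\<phi> \<in> choices. key \<phi> X = key \<phi> Y} \<le> card (PiE ({..<j * t} - I) (\<lambda>_. {..<b}))"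
    by (rule card_inj_on_le) (auto simp: choices_def finite_PiE)
  also have "\<dots> = b ^ (j * t - card I)"
    using I(1) by (simp add: card_PiE card_Diff_subset finite_subset)
  also have "\<dots> \<le> b ^ (j * t - t)" using I(2) pos by (intro power_increasing) auto
  finally have "real (card {\<phi> \<in> choices. key \<phi> X = key \<phi> Y}) \<le> real b ^ (j * t - t)"
    by (metis of_nat_le_iff of_nat_power)
  also have "\<dots> = real b ^ (j * t) / real b ^ t" using pos by (intro power_diff) auto
  finally show ?thesis by (simp add: card_choices)
qed

text \<open>All hidden coordinates lie at or above \<open>s\<close>, so collapsing cannot move a
  point into or out of \<open>U\<close>. The collision probability \<open>1 / real b ^ t\<close>
  enters as \<open>\<beta>\<close>.\<close>

lemma hidden_lower_bound:
  assumes T: "tolerant_junta_tester m k \<epsilon>1 \<epsilon>2 T" "makes_at_most q T"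
    and U: "U = {X \<in> Pow {..<m}. X \<inter> {..<s} \<in> R}"
    and far: "real (card {G \<in> Pow U. \<not> far_from_juntas m k \<epsilon>2 (\<lambda>x. ones x \<in> G)}) \<le> 2 ^ card U / 10"
    and close: "\<And>\<phi>. \<phi> \<in> choices \<Longrightarrow>
      real (card {G \<in> Pow U. \<not> close_to_junta m k \<epsilon>1 (\<lambda>x. key \<phi> (ones x) \<in> G)}) \<le> 2 ^ card U / 10"
  shows "real b ^ t < 4 * (real q)\<^sup>2"
proof -
  have finU: "finite U" using finite_subset[of U "Pow {..<m}"] by (auto simp: U)
  have "1 / 4 < (real q)\<^sup>2 * (1 / real b ^ t)"
  proof (rule tester_lower_bound[OF T finU finite_choices choices_nonempty, where K = "\<lambda>\<phi> x. key \<phi> (ones x)"])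
    show inj: "inj_on ones (cube m)" using bij_betw_ones by (rule bij_betw_imp_inj_on)
    show "key \<phi> (ones x) \<in> U \<longleftrightarrow> ones x \<in> U" if "\<phi> \<in> choices" "x \<in> cube m" for \<phi> x
    proof -
      interpret blocks m "hid \<phi>" "leaders \<phi>" "leader \<phi>" by (rule blocks_hidden[OF that(1)])
      have "collapse (ones x) \<inter> {..<s} = ones x \<inter> {..<s}"
        using collapse_diff[of "ones x"] hid_ge[of _ \<phi>] by fastforce
      then show ?thesis using ones_subset[OF that(2)] collapse_subset by (auto simp: U key_def)
    qed
    show "real (card {\<phi> \<in> choices. key \<phi> (ones x) = key \<phi> (ones y)}) \<le> 1 / real b ^ t * card choices"
      if "x \<in> cube m" "y \<in> cube m" "x \<noteq> y" for x y
      using inj that by (intro card_key_collision) (auto simp: inj_on_def)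
  qed (use far close in auto)
  then show ?thesis using pos by (simp add: field_simps)
qed

lemma U_invariant:
  assumes "U = {X \<in> Pow {..<m}. X \<inter> {..<s} \<in> R}" "X \<in> U" "Y \<subseteq> {..<m}" "X - hid \<phi> = Y - hid \<phi>"
  shows "Y \<in> U"
proof -
  have "X \<inter> {..<s} = Y \<inter> {..<s}" using assms(4) hid_ge[of _ \<phi>] by fastforce
  then show ?thesis using assms by auto
qed

end

lemma card_prefix_in:
  assumes "R \<subseteq> Pow {..<s}" "s \<le> m"
  shows "card {X \<in> Pow {..<m}. X \<inter> {..<s} \<in> R} = card R * 2 ^ (m - s)"
proof -
  have "bij_betw (\<lambda>(D, E). D \<union> E) (R \<times> Pow {s..<m}) {X \<in> Pow {..<m}. X \<inter> {..<s} \<in> R}"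
  proof (rule bij_betw_byWitness[where f' = "\<lambda>X. (X \<inter> {..<s}, X \<inter> {s..<m})"])
    have *: "(D \<union> E) \<inter> {..<s} = D" "(D \<union> E) \<inter> {s..<m} = E" if "D \<in> R" "E \<subseteq> {s..<m}" for D E
      using that assms(1) by fastforce+
    show "\<forall>p \<in> R \<times> Pow {s..<m}. ((case p of (D, E) \<Rightarrow> D \<union> E) \<inter> {..<s}, (case p of (D, E) \<Rightarrow> D \<union> E) \<inter> {s..<m}) = p"
      using * by auto
    show "\<forall>X \<in> {X \<in> Pow {..<m}. X \<inter> {..<s} \<in> R}.
        (case (X \<inter> {..<s}, X \<inter> {s..<m}) of (D, E) \<Rightarrow> D \<union> E) = X"
      by auto
    show "(\<lambda>(D, E). D \<union> E) ` (R \<times> Pow {s..<m}) \<subseteq> {X \<in> Pow {..<m}. X \<inter> {..<s} \<in> R}"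
      using * assms by fastforce
  qed auto
  then have "card (R \<times> Pow {s..<m}) = card {X \<in> Pow {..<m}. X \<inter> {..<s} \<in> R}"
    by (rule bij_betw_same_card)
  then show ?thesis by (simp add: card_cartesian_product card_Pow)
qed

section \<open>Two queries are always needed\<close>

text \<open>Flipping a coordinate outside \<open>S\<close> pairs even with odd sets inside each
  fibre, so all fibre sums vanish.\<close>

lemma far_from_juntas_parity:
  assumes "k < n" "\<epsilon> \<le> 1 / 2"
  shows "far_from_juntas n k \<epsilon> (\<lambda>x. odd (card (ones x)) = b)"
proof (rule far_from_juntas_fibre_sum)
  fix S assume S: "S \<subseteq> {..<n}" "card S = k"
  then have "S \<noteq> {..<n}" using assms(1) by auto
  then obtain i where i: "i < n" "i \<notin> S" using S(1) by auto
  define flip where "flip X = (if i \<in> X then X - {i} else insert i X)" for X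
  have flip: "odd (card (flip X)) \<longleftrightarrow> even (card X)" if "X \<subseteq> {..<n}" for X
  proof -
    have "finite X" using that finite_subset by blast
    then show ?thesis by (cases "i \<in> X") (auto simp: flip_def card_Diff_singleton card_gt_0_iff)
  qed
  have "(\<Sum>X \<in> {X \<in> Pow {..<n}. X \<inter> S = D}. pm (odd (card X) = b)) = 0" (is "?s = 0") for D
  proof -
    have "?s = (\<Sum>X \<in> {X \<in> Pow {..<n}. X \<inter> S = D}. - pm (odd (card X) = b))"
    proof (rule sum.reindex_bij_witness[where i = flip and j = flip])
      fix X assume "X \<in> {X \<in> Pow {..<n}. X \<inter> S = D}"
      then show "flip (flip X) = X" "flip X \<in> {X \<in> Pow {..<n}. X \<inter> S = D}"
        "- pm (odd (card (flip X)) = b) = pm (odd (card X) = b)"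
        using i flip[of X] by (auto simp: flip_def pm_def split: if_splits)
      then show "flip (flip X) = X" "flip X \<in> {X \<in> Pow {..<n}. X \<inter> S = D}" by auto
    qed
    then show ?thesis by (simp add: sum_negf)
  qed
  then have "fibre_sum S (Pow {..<n}) (\<lambda>X. pm (odd (card X) = b)) = 0"
    by (simp only: fibre_sum_def) simp
  then show "fibre_sum S (Pow {..<n}) (\<lambda>X. pm (odd (card X) = b)) \<le> (1 - 2 * \<epsilon>) * 2 ^ n"
    using assms(2) by simp
qed (use assms in simp)

lemma close_to_junta_const:
  assumes "0 \<le> \<epsilon>"
  shows "close_to_junta n k \<epsilon> (\<lambda>_. b)"
  unfolding close_to_junta_def
  by (rule exI[of _ "\<lambda>_. b"]) (use assms in \<open>simp add: junta_def depends_on_def distance_eq\<close>)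

text \<open>Averaged over \<open>b\<close>, the answer to a single query is a fair bit both for the
  constant function and for \<open>p x = b\<close>.\<close>

lemma one_query_tree:
  fixes p :: "bool list \<Rightarrow> bool"
  assumes "\<And>f. num_queries f t \<le> 1"
  shows "card {b \<in> UNIV. accepts (\<lambda>_. b) t} = card {b \<in> UNIV. accepts (\<lambda>x. p x = b) t}"
proof (cases t)
  case (Query x t0 t1)
  have "num_queries (\<lambda>_. False) t0 = 0" using assms[of "\<lambda>_. False"] by (simp add: Query)
  then obtain b0 where t0: "t0 = Answer b0" by (cases t0) auto
  have "num_queries (\<lambda>_. True) t1 = 0" using assms[of "\<lambda>_. True"] by (simp add: Query)
  then obtain b1 where t1: "t1 = Answer b1" by (cases t1) auto
  have "bij_betw (\<lambda>b. p x = b) {b \<in> UNIV. accepts (\<lambda>_. b) t} {b \<in> UNIV. accepts (\<lambda>x. p x = b) t}"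
    by (rule bij_betw_byWitness[where f' = "\<lambda>b. p x = b"]) (auto simp: Query t0 t1)
  then show ?thesis by (rule bij_betw_same_card)
qed simp

text \<open>Constants must be accepted, and parity and its negation rejected, although a single
  query does not separate the two pairs on average. The bound later absorbs the factor in
  \<open>4 * (real q)\<^sup>2\<close> and settles small \<open>k\<close>.\<close>

lemma at_least_two_queries:
  assumes T: "tolerant_junta_tester n k \<epsilon>1 \<epsilon>2 T" "makes_at_most q T"
    and "k < n" "0 \<le> \<epsilon>1" "\<epsilon>2 \<le> 1 / 2"
  shows "2 \<le> q"
proof (rule ccontr)
  assume "\<not> 2 \<le> q"
  have one: "num_queries f t \<le> 1" if "t \<in> set_pmf T" for f t
  proof -
    have "num_queries f t \<le> q" using T(2) that by (simp add: makes_at_most_def)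
    then show ?thesis using \<open>\<not> 2 \<le> q\<close> by linarith
  qed
  let ?p = "\<lambda>x. odd (card (ones x))"
  have "(\<Sum>b \<in> UNIV. measure_pmf.prob T {t. accepts (\<lambda>_. b) t})
      = measure_pmf.expectation T (\<lambda>t. real (card {b \<in> UNIV. accepts (\<lambda>_. b) t}))"
    by (rule sum_prob_eq_expectation_card) simp
  also have "\<dots> = measure_pmf.expectation T (\<lambda>t. real (card {b \<in> UNIV. accepts (\<lambda>x. ?p x = b) t}))"
    by (intro integral_cong_AE) (use one one_query_tree[where p = ?p] in \<open>auto simp: AE_measure_pmf_iff\<close>)
  also have "\<dots> = (\<Sum>b \<in> UNIV. measure_pmf.prob T {t. accepts (\<lambda>x. ?p x = b) t})"
    by (rule sum_prob_eq_expectation_card[symmetric]) simp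
  finally have eq: "(\<Sum>b \<in> UNIV. measure_pmf.prob T {t. accepts (\<lambda>_. b) t})
      = (\<Sum>b \<in> UNIV. measure_pmf.prob T {t. accepts (\<lambda>x. ?p x = b) t})" .
  have "(\<Sum>b \<in> (UNIV :: bool set). 2 / 3) \<le> (\<Sum>b \<in> UNIV. measure_pmf.prob T {t. accepts (\<lambda>_. b) t})"
    using T(1) close_to_junta_const[OF assms(4)]
    by (intro sum_mono) (simp add: tolerant_junta_tester_def)
  moreover have "(\<Sum>b \<in> UNIV. measure_pmf.prob T {t. accepts (\<lambda>x. ?p x = b) t}) \<le> (\<Sum>b \<in> (UNIV :: bool set). 1 / 3)"
  proof (rule sum_mono)
    fix b
    have "2 / 3 \<le> measure_pmf.prob T {t. \<not> accepts (\<lambda>x. ?p x = b) t}"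
      using T(1) far_from_juntas_parity[OF assms(3,5)] by (simp add: tolerant_junta_tester_def)
    also have "\<dots> = 1 - measure_pmf.prob T {t. accepts (\<lambda>x. ?p x = b) t}"
      by (subst measure_pmf.prob_compl[symmetric]) (auto intro!: arg_cong[where f = "measure_pmf.prob T"])
    finally show "measure_pmf.prob T {t. accepts (\<lambda>x. ?p x = b) t} \<le> 1 / 3" by simp
  qed
  ultimately show False using eq by (simp add: UNIV_bool)
qed

section \<open>Choice of parameters\<close>

text \<open>The binomial theorem at \<open>1 / 8\<close> bounds \<open>(k + a) choose a\<close> by
  \<open>(9 / 8) ^ k * 9 ^ a\<close>. Tenth powers turn \<open>a \<le> k / 10\<close> into integer
  exponents, and \<open>(9 / 8) ^ 10 * 9 < 32\<close> yields a ratio of at most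
  \<open>2 powr (- k / 2)\<close>.\<close>

lemma binomial_small:
  assumes "10 * a \<le> k" "8 \<le> k"
  shows "real ((k + a) choose k) / 2 ^ k \<le> 1 / 10"
proof -
  have "real ((k + a) choose a) * (1 / 8) ^ a \<le> (\<Sum>i\<le>k + a. real ((k + a) choose i) * (1 / 8) ^ i * 1 ^ (k + a - i))"
    using member_le_sum[of a "{..k + a}" "\<lambda>i. real ((k + a) choose i) * (1 / 8) ^ i * 1 ^ (k + a - i)"] by simp
  also have "\<dots> = (1 / 8 + 1) ^ (k + a)" by (rule binomial_ring[symmetric])
  finally have "real ((k + a) choose a) \<le> (9 / 8) ^ (k + a) * 8 ^ a" by (simp add: field_simps)
  also have "\<dots> = (9 / 8) ^ k * 9 ^ a" by (simp add: power_add power_divide)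
  finally have "real ((k + a) choose a) ^ 10 \<le> ((9 / 8) ^ k * 9 ^ a) ^ 10" by (intro power_mono) auto
  also have "\<dots> = ((9 / 8) ^ 10) ^ k * 9 ^ (10 * a)"
    by (simp only: power_mult_distrib power_mult[symmetric] mult.commute)
  also have "\<dots> \<le> ((9 / 8) ^ 10) ^ k * 9 ^ k"
    using assms(1) by (intro mult_left_mono power_increasing) auto
  also have "\<dots> = ((9 / 8) ^ 10 * 9) ^ k" by (simp add: power_mult_distrib)
  also have "\<dots> \<le> 32 ^ k" by (intro power_mono) (auto simp: power_divide)
  finally have "real ((k + a) choose a) ^ 10 \<le> 32 ^ k" .
  then have "(real ((k + a) choose a) / 2 ^ k) ^ 10 \<le> 32 ^ k / (2 ^ k) ^ 10"
    by (simp add: power_divide divide_right_mono)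
  also have "\<dots> = (1 / 32) ^ k"
  proof -
    have "((2 :: real) ^ k) ^ 10 = (2 ^ 10) ^ k" by (simp only: power_mult[symmetric] mult.commute)
    then show ?thesis by (simp add: power_divide[symmetric])
  qed
  also have "\<dots> \<le> (1 / 32) ^ 8" using assms(2) by (intro power_decreasing) auto
  also have "\<dots> \<le> (1 / 10) ^ 10" by (simp add: power_divide)
  finally have "real ((k + a) choose a) / 2 ^ k \<le> 1 / 10"
    by (rule power_le_imp_le_base[of _ 9, simplified]) simp
  moreover have "(k + a) choose k = (k + a) choose a"
    using binomial_symmetric[of k "k + a"] by simp
  ultimately show ?thesis by simp
qed

lemma sqrt_power_split:
  assumes "m = k + 22 * t"
  shows "sqrt (2 ^ k * 2 ^ m) = 2 ^ m * (1 / 2) ^ (11 * t)"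
proof (rule real_sqrt_unique)
  have "(2 ^ m * (1 / 2) ^ (11 * t))\<^sup>2 = 2 ^ m * (2 ^ m * (1 / 2 :: real) ^ (22 * t))"
    by (simp add: power2_eq_square mult_ac flip: power_add)
  also have "2 ^ m * (1 / 2 :: real) ^ (22 * t) = 2 ^ k"
    by (simp add: assms power_add power_divide)
  finally show "(2 ^ m * (1 / 2) ^ (11 * t))\<^sup>2 = 2 ^ k * (2 ^ m :: real)" by simp
qed simp

text \<open>Blocks of size one: collapsing them makes every function a \<open>k\<close>-junta.\<close>
lemma lower_bound_large_gap:
  assumes T: "tolerant_junta_tester n k \<epsilon>1 \<epsilon>2 T" "makes_at_most q T"
    and k: "220 \<le> k" and n: "k + 22 \<le> n" and \<epsilon>: "0 \<le> \<epsilon>1" "\<epsilon>2 \<le> 49 / 100"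
  shows "real ((k + 11) div 22) < 4 * (real q)\<^sup>2"
proof -
  define m b where "m = k + 22" and "b = (k + 11) div 22"
  \<comment> \<open>No point is forced to \<open>0\<close> here: the prefix of length
    \<open>0\<close> always passes. The slack \<open>1 - 2 * \<epsilon>2 \<ge> 1 / 50\<close>
    already exceeds the bias \<open>2 * (1 / 2) ^ 11\<close>.\<close>
  define U where "U = {X \<in> Pow {..<m}. X \<inter> {..<0} \<in> {{}}}"
  have U: "U = Pow {..<m}" by (auto simp: U_def)
  then have cU: "card U = 2 ^ m" by (simp add: card_Pow)
  interpret hidden m 0 b 22 1
    by unfold_locales (use k in \<open>auto simp: b_def m_def div_greater_zero_iff\<close>)
  have "real b ^ 1 < 4 * (real q)\<^sup>2"
  proof (rule hidden_lower_bound[OF tolerant_junta_tester_take[OF _ T(1)] makes_at_most_map_queries[OF T(2)] U_def])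
    show "m \<le> n" using n by (simp add: m_def)
    have "2 * sqrt (2 ^ k * 2 ^ m) = 2 ^ m * (2 * (1 / 2) ^ 11)"
      using sqrt_power_split[of m k 1] by (simp add: m_def)
    also have "\<dots> \<le> 2 ^ m * (1 - 2 * \<epsilon>2)" using \<epsilon> by (intro mult_left_mono) (auto simp: power_divide)
    finally have gap: "2 * sqrt (2 ^ k * 2 ^ m) \<le> real (card U) - 2 * \<epsilon>2 * 2 ^ m"
      by (simp add: cU algebra_simps)
    have "real (card {G \<in> Pow U. \<not> far_from_juntas m k \<epsilon>2 (\<lambda>x. ones x \<in> G)})
        \<le> 2 ^ card U * (real (m choose k) / 2 ^ k)"
      by (rule card_random_not_far[OF _ _ gap]) (auto simp: U m_def)
    also have "\<dots> \<le> 2 ^ card U * (1 / 10)"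
      unfolding m_def using k by (intro mult_left_mono binomial_small) auto
    finally show "real (card {G \<in> Pow U. \<not> far_from_juntas m k \<epsilon>2 (\<lambda>x. ones x \<in> G)}) \<le> 2 ^ card U / 10"
      by simp
    show "real (card {G \<in> Pow U. \<not> close_to_junta m k \<epsilon>1 (\<lambda>x. key \<phi> (ones x) \<in> G)}) \<le> 2 ^ card U / 10"
      if \<phi>: "\<phi> \<in> choices" for \<phi>
    proof -
      have "leaders \<phi> = hid \<phi>" unfolding leaders_def hid_def by simp
      then have "close_to_junta m k \<epsilon>1 (\<lambda>x. key \<phi> (ones x) \<in> G)" if "G \<subseteq> U" for G
        unfolding key_def
        using that \<epsilon>(1) card_hid[OF \<phi>]
        by (intro blocks.close_to_junta_all_leaders[OF blocks_hidden[OF \<phi>], where U = U]) (auto simp: U m_def)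
      then have "{G \<in> Pow U. \<not> close_to_junta m k \<epsilon>1 (\<lambda>x. key \<phi> (ones x) \<in> G)} = {}" by blast
      then show ?thesis by (simp only: card.empty) simp
    qed
  qed
  then show ?thesis by (simp add: b_def)
qed

text \<open>
  The bias of a random function is \<open>e = (1 / 2) ^ (11 * t)\<close>, and \<open>U\<close> gets a density between
  \<open>2 * \<epsilon>2 + 2 * e\<close> and \<open>2 * \<epsilon>2 + 3 * e\<close>, which puts the distance to juntas above \<open>\<epsilon>2\<close>.  With 22 blocks the
  bias grows by a factor \<open>2 ^ 11 / sqrt 3\<close>; since the density is at least \<open>1 / 50\<close>, this brings the
  distance below \<open>\<epsilon>2 - e \<le> \<epsilon>1\<close>.
\<close>
lemma lower_bound_small_gap:
  assumes T: "tolerant_junta_tester n k \<epsilon>1 \<epsilon>2 T" "makes_at_most q T"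
    and t: "0 < t" "220 * t \<le> k" and n: "k + 22 * t \<le> n"
    and \<epsilon>: "1 / 100 \<le> \<epsilon>1" "\<epsilon>2 \<le> 49 / 100" "\<epsilon>1 < \<epsilon>2" "\<epsilon>2 - \<epsilon>1 \<le> (1 / 2) ^ (11 * t)"
  shows "real ((k + 11 * t) div (22 * t)) ^ t < 4 * (real q)\<^sup>2"
proof -
  \<comment> \<open>The prefix length \<open>11 * t\<close> lets densities be prescribed in steps of
    exactly \<open>e = (1 / 2) ^ s\<close>. The other \<open>k + 11 * t\<close> coordinates are
    shared among \<open>22 * t\<close> bins, with \<open>b\<close> the largest bin width that
    fits.\<close>
  define m s b where "m = k + 22 * t" and "s = 11 * t" and "b = (k + 11 * t) div (22 * t)"
  define e :: real where "e = (1 / 2) ^ s"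
  have e: "0 < e" "2 ^ s * e = 1" by (auto simp: e_def power_divide)
  have "e \<le> (1 / 2) ^ 11" unfolding e_def s_def using t by (intro power_decreasing) auto
  then have e_small: "e \<le> 1 / 2048" by (simp add: power_divide)
  have sm: "s \<le> m" by (simp add: s_def m_def)
  \<comment> \<open>Since \<open>2 ^ s * e = 1\<close>, rounding up to a whole number of prefixes
    costs at most one \<open>e\<close>.\<close>
  define r where "r = nat \<lceil>2 ^ s * (2 * \<epsilon>2 + 2 * e)\<rceil>"
  have "0 \<le> 2 ^ s * (2 * \<epsilon>2 + 2 * e)" using \<epsilon> e by simp
  then have rr: "2 ^ s * (2 * \<epsilon>2 + 2 * e) \<le> real r" "real r \<le> 2 ^ s * (2 * \<epsilon>2 + 2 * e) + 1"
    unfolding r_def by linarith+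
  then have r_up: "real r \<le> 2 ^ s * (2 * \<epsilon>2 + 3 * e)" using e(2) by (simp add: algebra_simps)
  also have "\<dots> \<le> 2 ^ s * 1" using \<epsilon> e_small by (intro mult_left_mono) auto
  finally have "r \<le> card (Pow {..<s})" by (simp add: card_Pow flip: of_nat_le_iff)
  then obtain R where R: "R \<subseteq> Pow {..<s}" "card R = r" by (rule obtain_subset_with_card_n)
  define U where "U = {X \<in> Pow {..<m}. X \<inter> {..<s} \<in> R}"
  have U_sub: "U \<subseteq> Pow {..<m}" by (auto simp: U_def)
  have cU: "real (card U) = real r * 2 ^ (m - s)"
    unfolding U_def card_prefix_in[OF R(1) sm] R(2) by simp
  have split: "(2 :: real) ^ m = 2 ^ s * 2 ^ (m - s)" using sm by (simp flip: power_add)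
  have U_lo: "2 ^ m * (2 * \<epsilon>2 + 2 * e) \<le> real (card U)"
    using mult_right_mono[OF rr(1), of "2 ^ (m - s)"] unfolding cU split by (simp add: mult_ac)
  have U_up: "real (card U) \<le> 2 ^ m * (2 * \<epsilon>2 + 3 * e)"
    using mult_right_mono[OF r_up, of "2 ^ (m - s)"] unfolding cU split by (simp add: mult_ac)
  have U_lo': "2 ^ m * (1 / 50) \<le> real (card U)"
    by (rule order_trans[OF mult_left_mono U_lo]) (use \<epsilon> e in auto)
  have "b * (22 * t) \<le> k + 11 * t" unfolding b_def by (rule div_times_less_eq_dividend)
  then have fits: "s + b * (22 * t) \<le> m" by (simp add: s_def m_def)
  have "0 < b" using t by (simp add: b_def div_greater_zero_iff)
  then interpret hidden m s b 22 t
    by unfold_locales (use t fits in simp_all)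
  have "real b ^ t < 4 * (real q)\<^sup>2"
  proof (rule hidden_lower_bound[OF tolerant_junta_tester_take[OF _ T(1)] makes_at_most_map_queries[OF T(2)] U_def])
    show "m \<le> n" using n by (simp add: m_def)
    have "2 * sqrt (2 ^ k * 2 ^ m) = 2 ^ m * (2 * e)"
      using sqrt_power_split[OF m_def] by (simp add: e_def s_def)
    then have gap: "2 * sqrt (2 ^ k * 2 ^ m) \<le> real (card U) - 2 * \<epsilon>2 * 2 ^ m"
      using U_lo by (simp add: algebra_simps)
    have "real (card {G \<in> Pow U. \<not> far_from_juntas m k \<epsilon>2 (\<lambda>x. ones x \<in> G)})
        \<le> 2 ^ card U * (real (m choose k) / 2 ^ k)"
      by (rule card_random_not_far[OF U_sub _ gap]) (simp add: m_def)
    also have "\<dots> \<le> 2 ^ card U * (1 / 10)"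
      unfolding m_def using t by (intro mult_left_mono binomial_small) auto
    finally show "real (card {G \<in> Pow U. \<not> far_from_juntas m k \<epsilon>2 (\<lambda>x. ones x \<in> G)}) \<le> 2 ^ card U / 10"
      by simp
    show "real (card {G \<in> Pow U. \<not> close_to_junta m k \<epsilon>1 (\<lambda>x. key \<phi> (ones x) \<in> G)}) \<le> 2 ^ card U / 10"
      if \<phi>: "\<phi> \<in> choices" for \<phi>
    proof -
      define \<eta> :: real where "\<eta> = sqrt (2 ^ 22 / (3 * 2 ^ (22 * t)))"
      have "1024 * e \<le> \<eta>"
        unfolding \<eta>_def
      proof (rule real_le_rsqrt)
        have "e\<^sup>2 = (1 / 2) ^ (22 * t)" by (simp add: e_def s_def flip: power_mult)
        then show "(1024 * e)\<^sup>2 \<le> 2 ^ 22 / (3 * 2 ^ (22 * t))"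
          by (simp add: power_mult_distrib power_divide field_simps)
      qed
      have "real (card U) - 2 * \<epsilon>1 * 2 ^ m \<le> 2 ^ m * (2 * (\<epsilon>2 - \<epsilon>1) + 3 * e)"
        using U_up by (simp add: algebra_simps)
      also have "\<dots> \<le> 2 ^ m * (5 * e)"
        using \<epsilon>(4) by (intro mult_left_mono) (auto simp: e_def s_def)
      \<comment> \<open>Here the gain from the 22 blocks is spent: up to the factor
        \<open>2 ^ m\<close>, the right side is \<open>10.24 * e\<close>.\<close>
      also have "\<dots> \<le> 2 ^ m * (1 / 50) * (1024 * e / 2)" using e by simp
      also have "\<dots> \<le> real (card U) * (\<eta> / 2)"
        using U_lo' \<open>1024 * e \<le> \<eta>\<close> e by (intro mult_mono) auto
      finally have gap': "real (card U) - 2 * \<epsilon>1 * 2 ^ m \<le> real (card U) * \<eta> / 2" by simp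
      let ?B = "real (card {G \<in> Pow U. \<not> close_to_junta m k \<epsilon>1 (\<lambda>x. key \<phi> (ones x) \<in> G)})"
      have "?B * card U \<le> 2 ^ card U * (12 * 2 ^ (card (leaders \<phi>) + card (hid \<phi>)))"
        unfolding key_def
      proof (rule blocks.card_random_not_close[OF blocks_hidden[OF \<phi>] U_sub _ _ _ gap'])
        show "Y \<in> U" if "X \<in> U" "Y \<subseteq> {..<m}" "X - hid \<phi> = Y - hid \<phi>" for X Y
          by (rule U_invariant[OF U_def that])
      qed (auto simp: card_hid[OF \<phi>] card_leaders[OF \<phi>] m_def \<eta>_def)
      then have B: "?B * card U \<le> 2 ^ card U * (12 * 2 ^ (22 + 22 * t))"
        by (simp add: card_hid[OF \<phi>] card_leaders[OF \<phi>])
      have "?B * (2 ^ m * (1 / 50)) \<le> ?B * card U" using U_lo' by (intro mult_left_mono) auto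
      also note B
      \<comment> \<open>\<open>k\<close> is at least \<open>220\<close>, and \<open>2 ^ 35\<close>
        already exceeds \<open>12 * 500 * 2 ^ 22\<close>.\<close>
      also have "2 ^ card U * (12 * 2 ^ (22 + 22 * t)) \<le> 2 ^ card U / 10 * (2 ^ m * (1 / 50) :: real)"
      proof -
        have "(2 :: real) ^ 35 \<le> 2 ^ k" using t by (intro power_increasing) auto
        then have "12 * 2 ^ 22 \<le> 1 / 10 * (2 ^ k * (1 / 50) :: real)" by simp
        then have "12 * 2 ^ 22 * 2 ^ (22 * t) \<le> 1 / 10 * (2 ^ k * (1 / 50)) * (2 ^ (22 * t) :: real)"
          by (intro mult_right_mono) auto
        then have "12 * 2 ^ (22 + 22 * t) \<le> 1 / 10 * (2 ^ m * (1 / 50) :: real)"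
          by (simp add: m_def power_add mult_ac)
        from mult_left_mono[OF this, of "2 ^ card U"] show ?thesis by simp
      qed
      finally show ?thesis by (rule mult_right_le_imp_le) simp
    qed
  qed
  then show ?thesis by (simp add: b_def)
qed

text \<open>From \<open>q \<ge> 2\<close> follows
  \<open>4 * (real q)\<^sup>2 \<le> real q ^ 4\<close>, and the fourth root turns the exponent
  \<open>t / 200\<close> into \<open>t / 800\<close>.\<close>

lemma powr_le_from_power:
  fixes k q b :: nat
  assumes "2 \<le> q" "1 \<le> k" "real k powr (1 / 200) \<le> real b" "real b ^ t < 4 * (real q)\<^sup>2"
    and "y \<le> real t / 800"
  shows "real k powr y \<le> real q"
proof -
  have "real k powr (real t / 200) = (real k powr (1 / 200)) ^ t"
    using assms(2) by (simp add: powr_powr flip: powr_realpow)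
  also have "\<dots> \<le> real b ^ t" using assms(3) by (intro power_mono) auto
  also have "\<dots> \<le> 4 * (real q)\<^sup>2" using assms(4) by simp
  also have "\<dots> \<le> (real q)\<^sup>2 * (real q)\<^sup>2"
  proof (rule mult_right_mono)
    have "(2 :: real)\<^sup>2 \<le> (real q)\<^sup>2" using assms(1) by (intro power_mono) auto
    then show "4 \<le> (real q)\<^sup>2" by simp
  qed simp
  also have "\<dots> = real q ^ 4" by (simp flip: power_add)
  finally have "(real k powr (real t / 800)) ^ 4 \<le> real q ^ 4"
    using assms(2) by (simp add: powr_powr flip: powr_realpow)
  then have "real k powr (real t / 800) \<le> real q"
    by (rule power_le_imp_le_base[of _ 3, simplified]) simp
  moreover have "real k powr y \<le> real k powr (real t / 800)"
    using assms(2,5) by (intro powr_mono) auto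
  ultimately show ?thesis by simp
qed

text \<open>With \<open>z = real k powr (1 / 200) \<ge> 1\<close>, the product
  \<open>(z + 1) * 22 * t\<close> is at most \<open>44 * t * z\<close>, hence at most
  \<open>k\<close>. The larger factor \<open>220 = 10 * 22\<close> provides the hypothesis of the
  binomial estimate for \<open>22 * t\<close> additional variables.\<close>

lemma bins_lower_bound:
  fixes k t :: nat
  assumes "1 \<le> t" "220 * (real t * real k powr (1 / 200)) \<le> real k" "1 \<le> k"
  shows "220 * t \<le> k" "real k powr (1 / 200) \<le> real ((k + 11 * t) div (22 * t))"
proof -
  define z where "z = real k powr (1 / 200)"
  have z: "1 \<le> z" using assms(3) by (simp add: z_def ge_one_powr_ge_zero)
  have "real t * 1 \<le> real t * z" using z by (intro mult_left_mono) auto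
  then show k: "220 * t \<le> k" using assms(2) by (simp add: z_def flip: of_nat_le_iff)
  have "real (k + 11 * t) / real (22 * t) - 1 \<le> real ((k + 11 * t) div (22 * t))"
    using floor_divide_of_nat_eq[of "k + 11 * t" "22 * t", where ?'a = real] by linarith
  moreover have "z \<le> real (k + 11 * t) / real (22 * t) - 1"
  proof -
    have "(z + 1) * real (22 * t) \<le> 22 * (real t * z) + 22 * (real t * z)"
      using \<open>real t * 1 \<le> real t * z\<close> by (simp add: algebra_simps)
    also have "\<dots> \<le> real (k + 11 * t)" using assms(2) z by (simp add: z_def)
    finally show ?thesis using assms(1) by (simp add: field_simps)
  qed
  ultimately show "real k powr (1 / 200) \<le> real ((k + 11 * t) div (22 * t))" by (simp add: z_def)
qed

text \<open>The exponent \<open>1 / 200\<close> is half of \<open>1 - 0.99\<close>: with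
  \<open>t\<close> up to \<open>D * real k powr 0.99\<close>, one factor
  \<open>real k powr (1 / 200)\<close> absorbs the constant \<open>220 * D\<close>, and the other
  remains as a bin width.\<close>

lemma lower_bound_large_k:
  fixes k n q :: nat
  assumes T: "tolerant_junta_tester n k \<epsilon>1 \<epsilon>2 T" "makes_at_most q T" and n: "2 * k < n"
    and \<epsilon>: "1 / 100 \<le> \<epsilon>1" "\<epsilon>1 < \<epsilon>2" "\<epsilon>2 \<le> 49 / 100"
    and D: "1 \<le> D" and Dk: "220 * D \<le> real k powr (1 / 200)" and \<delta>: "- log 2 (\<epsilon>2 - \<epsilon>1) \<le> D * real k powr 0.99"
  shows "real k powr (- log 2 (\<epsilon>2 - \<epsilon>1) / 20000) \<le> real q"
proof -
  define l where "l = - log 2 (\<epsilon>2 - \<epsilon>1)"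
  have q: "2 \<le> q" by (rule at_least_two_queries[OF T]) (use n \<epsilon> in auto)
  have k1: "1 \<le> k" using Dk D by (cases "k = 0") auto
  have fit: "220 * (real t * real k powr (1 / 200)) \<le> real k" if "real t \<le> D * real k powr 0.99" for t
  proof -
    have "220 * (real t * real k powr (1 / 200)) \<le> 220 * (D * real k powr 0.99 * real k powr (1 / 200))"
      using that by (intro mult_left_mono mult_right_mono) auto
    also have "\<dots> = 220 * D * (real k powr 0.99 * real k powr (1 / 200))" by simp
    also have "\<dots> \<le> real k powr (1 / 200) * (real k powr 0.99 * real k powr (1 / 200))"
      using Dk by (intro mult_right_mono) auto
    also have "\<dots> = real k powr 1" by (simp flip: powr_add)
    finally show ?thesis using k1 by simp
  qed
  have k99: "1 \<le> real k powr 0.99" using k1 by (simp add: ge_one_powr_ge_zero)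
  show ?thesis
  proof (cases "11 \<le> l")
    case False
    have t: "real 1 \<le> D * real k powr 0.99" using mult_mono[OF D k99] D by simp
    note b = bins_lower_bound[OF order_refl fit[OF t] k1]
    have "real ((k + 11 * 1) div (22 * 1)) ^ 1 < 4 * (real q)\<^sup>2"
      using lower_bound_large_gap[OF T] b(1) n \<epsilon> by simp
    then have "real k powr (l / 20000) \<le> real q"
      by (rule powr_le_from_power[OF q k1 b(2)]) (use False in simp)
    then show ?thesis by (simp add: l_def)
  next
    case True
    \<comment> \<open>Rounding down ensures that the gap is at most
      \<open>(1 / 2) ^ (11 * t)\<close>.\<close>
    define t where "t = nat \<lfloor>l / 11\<rfloor>"
    have t: "1 \<le> t" "real t \<le> l / 11" "l / 11 < real t + 1"
      using True unfolding t_def by linarith+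
    have "real t \<le> D * real k powr 0.99" using t(2) \<delta> True by (simp add: l_def)
    note b = bins_lower_bound[OF t(1) fit[OF this] k1]
    have "\<epsilon>2 - \<epsilon>1 = 2 powr (- l)" using \<epsilon> by (simp add: l_def)
    also have "\<dots> \<le> 2 powr (- real (11 * t))" using t(2) by (intro powr_mono) auto
    also have "\<dots> = (1 / 2) ^ (11 * t)"
      unfolding powr_minus powr_realpow[OF zero_less_numeral] by (simp add: power_divide inverse_eq_divide)
    finally have "real ((k + 11 * t) div (22 * t)) ^ t < 4 * (real q)\<^sup>2"
      using t(1) b(1) n \<epsilon> by (intro lower_bound_small_gap[OF T]) auto
    \<comment> \<open>\<open>l / 11 < t + 1 \<le> 2 * t\<close>, so \<open>l < 22 * t\<close>, and
      \<open>22 / 20000 < 1 / 800\<close>.\<close>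
    moreover have "l / 20000 \<le> real t / 800" using t by linarith
    ultimately have "real k powr (l / 20000) \<le> real q" by (rule powr_le_from_power[OF q k1 b(2)])
    then show ?thesis by (simp add: l_def)
  qed
qed

theorem theorem1:
  "\<forall>C::real. C > 0 \<longrightarrow>
     (\<exists>c::real. c > 0 \<and>
       (\<forall>(k::nat) (\<epsilon>1::real) (\<epsilon>2::real).
          0 < k \<and> 0.01 \<le> \<epsilon>1 \<and> \<epsilon>1 < \<epsilon>2 \<and> \<epsilon>2 \<le> 0.49 \<and>
          \<epsilon>2 - \<epsilon>1 \<ge> 2 powr (- C * real k powr 0.99) \<longrightarrow>
          (\<exists>N::nat. \<forall>n\<ge>N. \<forall>(T::query_tree pmf) (q::nat).
             tolerant_junta_tester n k \<epsilon>1 \<epsilon>2 T \<and> makes_at_most q T \<longrightarrow>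
             real q \<ge> real k powr (- c * log 2 (\<epsilon>2 - \<epsilon>1)))))"
proof (intro allI impI)
  fix C :: real assume C: "C > 0"
  define D where "D = max 1 C"
  \<comment> \<open>Chosen so that \<open>K \<le> k\<close> implies
    \<open>220 * D \<le> real k powr (1 / 200)\<close>.\<close>
  define K where "K = (220 * D) powr 200"
  have D1: "1 \<le> D" by (simp add: D_def)
  then have K: "1 \<le> K" unfolding K_def by (intro ge_one_powr_ge_zero) auto
  \<comment> \<open>The second bound is for \<open>k < K\<close>: then
    \<open>- log 2 (\<epsilon>2 - \<epsilon>1) \<le> C * K\<close> and
    \<open>log 2 k \<le> K\<close>, so the claimed number of queries is at most
    \<open>2\<close>.\<close>
  define c where "c = min (1 / 20000) (1 / (C * K\<^sup>2))"
  have c: "0 < c" "c \<le> 1 / 20000" "c \<le> 1 / (C * K\<^sup>2)" using C K by (auto simp: c_def)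
  \<comment> \<open>The threshold \<open>2 * k + 1\<close> leaves room for the at most
    \<open>k + k / 10\<close> variables in use and gives the strict \<open>k < n\<close> of the
    parity argument.\<close>
  have main: "real q \<ge> real k powr (- c * log 2 (\<epsilon>2 - \<epsilon>1))"
    if k: "0 < k" and \<epsilon>: "0.01 \<le> \<epsilon>1" "\<epsilon>1 < \<epsilon>2" "\<epsilon>2 \<le> 0.49"
      and \<delta>: "\<epsilon>2 - \<epsilon>1 \<ge> 2 powr (- C * real k powr 0.99)" and n: "n \<ge> 2 * k + 1"
      and T: "tolerant_junta_tester n k \<epsilon>1 \<epsilon>2 T" "makes_at_most q T"
    for k n q :: nat and \<epsilon>1 \<epsilon>2 :: real and T
  proof -
    define l where "l = - log 2 (\<epsilon>2 - \<epsilon>1)"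
    have l0: "0 \<le> l" using \<epsilon> by (simp add: l_def)
    have "log 2 (2 powr (- C * real k powr 0.99)) \<le> log 2 (\<epsilon>2 - \<epsilon>1)"
      using \<delta> \<epsilon> by (subst log_le_cancel_iff) auto
    then have l: "l \<le> C * real k powr 0.99" by (simp add: l_def)
    show ?thesis
    proof (cases "K \<le> real k")
      case True
      have "l \<le> D * real k powr 0.99"
        by (rule order_trans[OF l]) (auto simp: D_def intro: mult_right_mono)
      moreover have "220 * D \<le> real k powr (1 / 200)"
      proof -
        have "220 * D = K powr (1 / 200)" unfolding K_def powr_powr using D1 by simp
        also have "\<dots> \<le> real k powr (1 / 200)" using True K by (intro powr_mono2) auto
        finally show ?thesis .
      qed
      ultimately have "real k powr (- log 2 (\<epsilon>2 - \<epsilon>1) / 20000) \<le> real q"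
        using n \<epsilon> unfolding l_def by (intro lower_bound_large_k[OF T _ _ _ _ D1]) simp_all
      then have "real k powr (l / 20000) \<le> real q" by (simp add: l_def)
      moreover have "real k powr (c * l) \<le> real k powr (l / 20000)"
        using k mult_right_mono[OF c(2) l0] by (intro powr_mono) auto
      ultimately show ?thesis by (simp add: l_def)
    next
      case False
      have "real k powr 0.99 \<le> real k powr 1" using k by (intro powr_mono) auto
      then have "l \<le> C * K" using l False C k
        by (intro order_trans[OF l] mult_left_mono) auto
      have "log 2 (real k) \<le> real k"
        using k less_exp[of k] by (subst log_le_iff) (auto simp: powr_realpow less_imp_le simp flip: of_nat_less_iff)
      then have "c * l * log 2 (real k) \<le> 1 / (C * K\<^sup>2) * (C * K) * K"
        using c(1,3) \<open>l \<le> C * K\<close> l0 False k C K by (intro mult_mono) auto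
      also have "\<dots> = 1" using C K by (simp add: power2_eq_square)
      finally have "2 powr (c * l * log 2 (real k)) \<le> 2 powr 1" by (intro powr_mono) auto
      moreover have "2 powr (c * l * log 2 (real k)) = real k powr (c * l)"
        using k powr_powr[of 2 "log 2 (real k)" "c * l"] by (simp add: mult_ac)
      moreover have "2 \<le> q" by (rule at_least_two_queries[OF T]) (use n \<epsilon> in auto)
      ultimately show ?thesis by (simp add: l_def)
    qed
  qed
  show "\<exists>c>0. \<forall>(k::nat) \<epsilon>1 \<epsilon>2. 0 < k \<and> 0.01 \<le> \<epsilon>1 \<and> \<epsilon>1 < \<epsilon>2 \<and> \<epsilon>2 \<le> 0.49 \<and>
      \<epsilon>2 - \<epsilon>1 \<ge> 2 powr (- C * real k powr 0.99) \<longrightarrow>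
      (\<exists>N::nat. \<forall>n\<ge>N. \<forall>(T::query_tree pmf) (q::nat).
        tolerant_junta_tester n k \<epsilon>1 \<epsilon>2 T \<and> makes_at_most q T \<longrightarrow>
        real q \<ge> real k powr (- c * log 2 (\<epsilon>2 - \<epsilon>1)))"
    using main c(1) by (intro exI[of _ c] conjI allI impI) blast+
qed

end
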